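(* Let $n>1$ be an integer, let $K\ge1$, $K'\ge0$ be constants, and let $f:B^n\to\mathbb{C}^n$ be a $(K,K')$-quasiregular pluriharmonic mapping such that $\widetilde{\lambda}_f(0)=1$. Then $f(B^n)$ contains a schlicht ball of radius $b_f$, with $$b_f\ge\frac{\pi}{4(3K+2K')}.$$
   Context: $B^n=\{z\in\mathbb{C}^n:|z|<1\}$ is the open unit ball for the Euclidean norm. A continuous complex-valued function $\phi$ on a domain $\Omega\subset\mathbb{C}^n$ is pluriharmonic if for each $z'\in\Omega$ and $\theta\in\partial B^n$ the function $\zeta\mapsto\phi(z'+\theta\zeta)$ is harmonic in $\{\zeta\in\mathbb{C}:|\zeta|<d_\Omega(z')\}$, where $d_\Omega(z')$ is the distance from $z'$ to $\partial\Omega$. A mapping into $\mathbb{C}^n$ is pluriharmonic if every component is pluriharmonic. For a continuously differentiable $f=(f_1,\dots,f_n):B^n\to\mathbb{C}^n$, $f_z=(\partial f_j/\partial z_k)$ and $f_{\bar z}=(\partial f_j/\partial\bar z_k)$ are $n\times n$ matrices, and $$\widetilde{\Lambda}_f(z)=\max_{\theta\in\partial B^n}|f_z(z)\theta+f_{\bar z}(z)\bar\theta|,\qquad \widetilde{\lambda}_f(z)=\min_{\theta\in\partial B^n}|f_z(z)\theta+f_{\bar z}(z)\bar\theta|,$$ with $\theta$ regarded as a column vector. For $K\ge1$, $K'\ge0$, a pluriharmonic mapping $f:B^n\to\mathbb{C}^n$ is called a $(K,K')$-quasiregular pluriharmonic mapping if $\widetilde{\Lambda}_f(z)\le K\,\widetilde{\lambda}_f(z)^{1/n}+K'$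 for all $z\in B^n$. A schlicht ball of $f$ is a ball in $\mathbb{C}^n$ that is the univalent (injective) image under $f$ of some subdomain (nonempty connected open subset) of $B^n$. *)

theory Defs
  imports "HOL-Analysis.Analysis"
begin

definition dir_deriv ::
    "'a::real_normed_vector \<Rightarrow> ('a \<Rightarrow> 'b::real_normed_vector) \<Rightarrow> 'a \<Rightarrow> 'b" where
  "dir_deriv v g x = vector_derivative (\<lambda>t::real. g (x + t *\<^sub>R v)) (at 0)"

definition cont_diff_on :: "'a::euclidean_space set \<Rightarrow> ('a \<Rightarrow> 'b::real_normed_vector) \<Rightarrow> bool" where
  "cont_diff_on S g \<longleftrightarrow>
     (\<forall>b\<in>Basis. (\<forall>x\<in>S. (\<lambda>t::real. g (x + t *\<^sub>R b)) differentiable (at 0)) \<and>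
                continuous_on S (dir_deriv b g))"

definition laplacian :: "('a::euclidean_space \<Rightarrow> 'b::real_normed_vector) \<Rightarrow> 'a \<Rightarrow> 'b" where
  "laplacian g x = (\<Sum>b\<in>Basis. dir_deriv b (dir_deriv b g) x)"

text \<open>Intended for open sets: the function is twice continuously differentiable with vanishing
  Laplacian. On the complex plane \<^term>\<open>Basis\<close> consists of \<open>1\<close> and the imaginary unit, so the
  directional derivatives are the partial derivatives in \<open>x\<close> and \<open>y\<close>.\<close>

definition harmonic_on :: "complex set \<Rightarrow> (complex \<Rightarrow> complex) \<Rightarrow> bool" where
  "harmonic_on S g \<longleftrightarrow>
     cont_diff_on S g \<and> (\<forall>b\<in>Basis. cont_diff_on S (dir_deriv b g)) \<and>
     (\<forall>\<zeta>\<in>S. laplacian g \<zeta> = 0)"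

text \<open>The distance to the boundary is extended-real valued so that it is infinite for the whole
  space.\<close>

definition boundary_dist :: "'a::metric_space set \<Rightarrow> 'a \<Rightarrow> ereal" where
  "boundary_dist \<Omega> z = (INF w\<in>frontier \<Omega>. ereal (dist z w))"

definition pluriharmonic_on :: "(complex^'n) set \<Rightarrow> (complex^'n \<Rightarrow> complex) \<Rightarrow> bool" where
  "pluriharmonic_on \<Omega> \<phi> \<longleftrightarrow>
     continuous_on \<Omega> \<phi> \<and>
     (\<forall>z\<in>\<Omega>. \<forall>\<theta>\<in>sphere 0 1.
        harmonic_on {\<zeta>. ereal (cmod \<zeta>) < boundary_dist \<Omega> z} (\<lambda>\<zeta>. \<phi> (z + \<zeta> *s \<theta>)))"

definition pluriharmonic_map_on :: "(complex^'n) set \<Rightarrow> (complex^'n \<Rightarrow> complex^'m) \<Rightarrow> bool" where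
  "pluriharmonic_map_on \<Omega> f \<longleftrightarrow> (\<forall>j. pluriharmonic_on \<Omega> (\<lambda>z. f z $ j))"

text \<open>Writing \<open>z\<^sub>k = x\<^sub>k + \<i> y\<^sub>k\<close>, the partial derivatives in \<open>x\<^sub>k\<close> and \<open>y\<^sub>k\<close> are the directional
  derivatives along \<^term>\<open>axis k 1\<close> and \<^term>\<open>axis k \<i>\<close>.\<close>

definition wirtinger :: "'n \<Rightarrow> (complex^'n \<Rightarrow> complex) \<Rightarrow> complex^'n \<Rightarrow> complex" where
  "wirtinger k \<phi> z = (dir_deriv (axis k 1) \<phi> z - \<i> * dir_deriv (axis k \<i>) \<phi> z) / 2"

definition wirtinger_bar :: "'n \<Rightarrow> (complex^'n \<Rightarrow> complex) \<Rightarrow> complex^'n \<Rightarrow> complex" where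
  "wirtinger_bar k \<phi> z = (dir_deriv (axis k 1) \<phi> z + \<i> * dir_deriv (axis k \<i>) \<phi> z) / 2"

definition jac_z :: "(complex^'n \<Rightarrow> complex^'n) \<Rightarrow> complex^'n \<Rightarrow> complex^'n^'n" where
  "jac_z f z = (\<chi> j k. wirtinger k (\<lambda>w. f w $ j) z)"

definition jac_zbar :: "(complex^'n \<Rightarrow> complex^'n) \<Rightarrow> complex^'n \<Rightarrow> complex^'n^'n" where
  "jac_zbar f z = (\<chi> j k. wirtinger_bar k (\<lambda>w. f w $ j) z)"

definition vec_cnj :: "complex^'n \<Rightarrow> complex^'n" where
  "vec_cnj \<theta> = (\<chi> k. cnj (\<theta> $ k))"

text \<open>The maximum and minimum over the unit sphere are written as \<^term>\<open>Sup\<close> and \<^term>\<open>Inf\<close>;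
  both are attained, a continuous function being taken over a nonempty compact set.\<close>

definition Lambda_max :: "(complex^'n \<Rightarrow> complex^'n) \<Rightarrow> complex^'n \<Rightarrow> real" where
  "Lambda_max f z = (SUP \<theta>\<in>sphere 0 1. norm (jac_z f z *v \<theta> + jac_zbar f z *v vec_cnj \<theta>))"

definition lambda_min :: "(complex^'n \<Rightarrow> complex^'n) \<Rightarrow> complex^'n \<Rightarrow> real" where
  "lambda_min f z = (INF \<theta>\<in>sphere 0 1. norm (jac_z f z *v \<theta> + jac_zbar f z *v vec_cnj \<theta>))"

text \<open>Continuous differentiability is not a separate requirement: pluriharmonic mappings are
  smooth.\<close>

definition quasiregular_pluriharmonic ::
    "real \<Rightarrow> real \<Rightarrow> (complex^'n \<Rightarrow> complex^'n) \<Rightarrow> bool" where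
  "quasiregular_pluriharmonic K K' f \<longleftrightarrow>
     pluriharmonic_map_on (ball 0 1) f \<and>
     (\<forall>z\<in>ball 0 1. Lambda_max f z \<le> K * root CARD('n) (lambda_min f z) + K')"

definition schlicht_ball ::
    "(complex^'n \<Rightarrow> complex^'n) \<Rightarrow> complex^'n \<Rightarrow> real \<Rightarrow> bool" where
  "schlicht_ball f w r \<longleftrightarrow>
     (\<exists>G. open G \<and> connected G \<and> G \<noteq> {} \<and> G \<subseteq> ball 0 1 \<and> inj_on f G \<and> f ` G = ball w r)"

end

theory Submission
  imports Defs "HOL-Complex_Analysis.Complex_Analysis"
begin

text \<open>The proof has an analytic half and a combinatorial half. Write \<open>\<lambda>\<close>, \<open>\<Lambda>\<close> for \<^const>\<open>lambda_min\<close> and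
\<^const>\<open>Lambda_max\<close>, and \<open>u = \<lambda>\<^sup>1\<^sup>/\<^sup>n\<close>.

The analytic half is a Landau theorem (\<open>Landau_schlicht_ball\<close>): if \<open>\<Lambda> \<le> M\<close> on the ball of radius \<open>R\<close> about \<open>0\<close>
and \<open>\<lambda>(z0) \<ge> a\<close> at a point with \<open>|z0| \<le> p < R\<close>, then \<open>f\<close> has a schlicht ball about \<open>f z0\<close> of radius
\<open>a\<^sup>2 D / (2 (M R + a p))\<close> with \<open>D = R\<^sup>2 - p\<^sup>2\<close>. For a unit vector \<open>e\<close> the real function \<open>f \<bullet> e\<close> is pluriharmonic,
so its derivative in a fixed direction \<open>v\<close> is the real part of a function which is holomorphic on every complex line
and bounded by \<open>M\<close> (\<open>dz_slice_holomorphic\<close>, \<open>norm_dz_slice_inner_le\<close>). The Schwarz--Pick lemma for this scalar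
holomorphic function, on the disc that the line through \<open>z0\<close> and \<open>z\<close> cuts out of the ball, shows that with
\<open>r = a D / (M R + a p)\<close> the derivative stays at least \<open>a (1 - |z - z0| / r)\<close> (\<open>real_deriv_inner_lower_bound\<close>).
Injectivity on the ball of radius \<open>r\<close> about \<open>z0\<close> follows by integrating along segments, and integrating along radii
gives the size \<open>a r / 2\<close> of the image. Passing to a holomorphic function is what makes the constant good enough: a
Schwarz lemma for bounded harmonic maps would cost a factor \<open>4/\<pi>\<close>.

The combinatorial half chooses \<open>z0\<close>. As \<open>n > 1\<close>, the inequality \<open>u\<^sup>n = \<lambda> \<le> \<Lambda> \<le> K u + K'\<close> bounds \<open>u\<close> by the positive root
\<open>Y\<close> of \<open>Y\<^sup>2 = K Y + K'\<close>. If the ball about \<open>f 0\<close> given by the Landau theorem is too small, then \<open>u\<close> must be large at some point \<open>z1\<close> with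
\<open>|z1| < R\<close>; this point is tried next, with a larger \<open>R\<close>, and so on. Along a suitable sequence of radii increasing to \<open>1\<close>
the lower bounds for \<open>u\<close> at the successive points would eventually double at each step, which contradicts \<open>u \<le> Y\<close> (\<open>no_escape\<close>). Since \<open>3 K + 2 K'\<close> and \<open>K m + K'\<close> are both affine in \<open>K\<close> after substituting
\<open>K' = Y (Y - K)\<close>, the condition for each step only has to be verified for \<open>K = Y\<close> and for \<open>K = 0\<close>, which removes
\<open>K\<close> and \<open>K'\<close> from the numerical work.\<close>

section \<open>Functions with a continuous directional derivative\<close>

text \<open>Continuous differentiability along a single direction. Keeping track of directions separately suits functions that are
only known to be harmonic on each complex line.\<close>

definition dir_C1_on ::
    "'a::real_normed_vector set \<Rightarrow> 'a \<Rightarrow> ('a \<Rightarrow> 'b::real_normed_vector) \<Rightarrow> bool" where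
  "dir_C1_on S v g \<longleftrightarrow>
     (\<forall>x\<in>S. (\<lambda>t::real. g (x + t *\<^sub>R v)) differentiable (at 0)) \<and> continuous_on S (dir_deriv v g)"

lemma dir_C1_on_cont: "dir_C1_on S v g \<Longrightarrow> continuous_on S (dir_deriv v g)"
  by (simp add: dir_C1_on_def)

lemma dir_deriv_works:
  fixes g :: "'a::real_normed_vector \<Rightarrow> 'b::real_normed_vector"
  assumes "(\<lambda>t::real. g (x + t *\<^sub>R v)) differentiable (at 0)"
  shows "((\<lambda>t. g (x + t *\<^sub>R v)) has_vector_derivative dir_deriv v g x) (at 0)"
  using assms unfolding dir_deriv_def by (simp add: vector_derivative_works)

lemma dir_deriv_eqI:
  fixes g :: "'a::real_normed_vector \<Rightarrow> 'b::real_normed_vector"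
  assumes "((\<lambda>t. g (x + t *\<^sub>R v)) has_vector_derivative d) (at 0)"
  shows "dir_deriv v g x = d"
  using assms unfolding dir_deriv_def by (rule vector_derivative_at)

lemma dir_deriv_along_line:
  fixes g :: "'a::real_normed_vector \<Rightarrow> 'b::real_normed_vector"
  assumes "dir_C1_on S v g" and "x + s *\<^sub>R v \<in> S"
  shows "((\<lambda>t. g (x + t *\<^sub>R v)) has_vector_derivative dir_deriv v g (x + s *\<^sub>R v)) (at s)"
proof -
  have "((\<lambda>t. g ((x + s *\<^sub>R v) + t *\<^sub>R v)) has_vector_derivative dir_deriv v g (x + s *\<^sub>R v)) (at 0)"
    using assms by (intro dir_deriv_works) (simp add: dir_C1_on_def)
  then have shifted: "((\<lambda>t. g ((x + s *\<^sub>R v) + t *\<^sub>R v)) has_vector_derivative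
      dir_deriv v g (x + s *\<^sub>R v)) (at (s - s))"
    by simp
  have "((\<lambda>t. t - s) has_vector_derivative 1) (at s)"
    by (auto intro!: derivative_eq_intros)
  from vector_diff_chain_at[OF this shifted] show ?thesis
    by (simp add: o_def algebra_simps)
qed

text \<open>Existence of both partial derivatives and continuity of one of them give total differentiability in the plane spanned by
the two directions. This is the source of the linearity of \<^const>\<open>dir_deriv\<close> in its direction.\<close>

lemma has_derivative_plane:
  fixes g :: "'a::real_normed_vector \<Rightarrow> 'b::real_normed_vector"
  assumes S: "open S" "x \<in> S" and v: "dir_C1_on S v g" and w: "dir_C1_on S w g"
  shows "((\<lambda>(a, b). g (x + a *\<^sub>R v + b *\<^sub>R w)) has_derivative
            (\<lambda>(a, b). a *\<^sub>R dir_deriv v g x + b *\<^sub>R dir_deriv w g x)) (at (0::real, 0::real))"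
proof -
  define T where "T = (\<lambda>p::real \<times> real. x + fst p *\<^sub>R v + snd p *\<^sub>R w) -` S"
  have "open T"
    unfolding T_def using S by (intro open_vimage continuous_intros) auto
  moreover have "(0, 0) \<in> T" using S by (simp add: T_def)
  ultimately obtain A B where AB: "open A" "open B" "(0,0) \<in> A \<times> B" "A \<times> B \<subseteq> T"
    by (elim open_prod_elim)
  then obtain e where e: "e > 0" "ball 0 e \<subseteq> B"
    by (metis mem_Sigma_iff openE)
  define Y where "Y = ball (0::real) e"
  have sub: "x + a *\<^sub>R v + b *\<^sub>R w \<in> S" if "a \<in> A" "b \<in> Y" for a b
  proof -
    have "(a, b) \<in> A \<times> B" using that e by (auto simp: Y_def)
    then show ?thesis using AB(4) by (auto simp: T_def)
  qed
  have "((\<lambda>(a, b). g (x + a *\<^sub>R v + b *\<^sub>R w)) has_derivative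
           (\<lambda>(ta, tb). ta *\<^sub>R dir_deriv v g x +
               blinfun_apply (blinfun_scaleR_left (dir_deriv w g (x + 0 *\<^sub>R v + 0 *\<^sub>R w))) tb))
           (at (0::real, 0::real) within A \<times> Y)"
  proof (rule has_derivative_partialsI
      [where fy = "\<lambda>a b. blinfun_scaleR_left (dir_deriv w g (x + a *\<^sub>R v + b *\<^sub>R w))"])
    have "((\<lambda>a. g (x + a *\<^sub>R v)) has_vector_derivative dir_deriv v g x) (at 0)"
      using v S by (intro dir_deriv_works) (simp add: dir_C1_on_def)
    then show "((\<lambda>a. g (x + a *\<^sub>R v + 0 *\<^sub>R w)) has_derivative (\<lambda>t. t *\<^sub>R dir_deriv v g x)) (at 0 within A)"
      by - (rule has_derivative_at_withinI, simp add: has_vector_derivative_def)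
  next
    fix a b assume "a \<in> A" "b \<in> Y"
    then have "((\<lambda>b. g (x + a *\<^sub>R v + b *\<^sub>R w)) has_vector_derivative
        dir_deriv w g (x + a *\<^sub>R v + b *\<^sub>R w)) (at b within Y)"
      by (intro has_vector_derivative_at_within[OF dir_deriv_along_line[OF w]] sub)
    then show "((\<lambda>b. g (x + a *\<^sub>R v + b *\<^sub>R w)) has_derivative
        blinfun_apply (blinfun_scaleR_left (dir_deriv w g (x + a *\<^sub>R v + b *\<^sub>R w)))) (at b within Y)"
      by (simp add: has_vector_derivative_def)
  next
    have "continuous_on (A \<times> Y) (\<lambda>p. dir_deriv w g (x + fst p *\<^sub>R v + snd p *\<^sub>R w))"
      by (intro continuous_on_compose2[OF dir_C1_on_cont[OF w]] continuous_intros) (use sub in auto)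
    then have "continuous_on (A \<times> Y) (\<lambda>p. blinfun_scaleR_left (dir_deriv w g (x + fst p *\<^sub>R v + snd p *\<^sub>R w)))"
      by (intro continuous_intros)
    then show "continuous (at (0, 0) within A \<times> Y)
        (\<lambda>(a, b). blinfun_scaleR_left (dir_deriv w g (x + a *\<^sub>R v + b *\<^sub>R w)))"
      unfolding case_prod_beta' continuous_on_eq_continuous_within
      by (rule bspec) (use AB e in \<open>simp add: Y_def\<close>)
  qed (use e in \<open>auto simp: Y_def\<close>)
  moreover have "(0, 0) \<in> A \<times> Y" "open (A \<times> Y)"
    using AB e by (auto simp: Y_def open_Times)
  ultimately show ?thesis
    by (simp only: at_within_open) simp
qed

lemma dir_deriv_add:
  fixes g :: "'a::real_normed_vector \<Rightarrow> 'b::real_normed_vector"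
  assumes "open S" "x \<in> S" "dir_C1_on S v g" "dir_C1_on S w g"
  shows "((\<lambda>t. g (x + t *\<^sub>R (v + w))) has_vector_derivative dir_deriv v g x + dir_deriv w g x) (at 0)"
proof -
  have "((\<lambda>(a, b). g (x + a *\<^sub>R v + b *\<^sub>R w)) \<circ> (\<lambda>t. (t, t)) has_derivative
         (\<lambda>(a, b). a *\<^sub>R dir_deriv v g x + b *\<^sub>R dir_deriv w g x) \<circ> (\<lambda>t. (t, t))) (at (0::real))"
  proof (rule diff_chain_at)
    show "((\<lambda>t. (t, t)) has_derivative (\<lambda>t. (t, t))) (at (0::real))"
      by (intro has_derivative_Pair has_derivative_ident)
  qed (use has_derivative_plane[OF assms] in simp)
  then show ?thesis
    by (simp add: has_vector_derivative_def o_def scaleR_add_right add.assoc)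
qed

lemma has_derivative_complex_plane:
  fixes g :: "'a::real_normed_vector \<Rightarrow> 'b::real_normed_vector"
  assumes "open S" "x \<in> S" "dir_C1_on S v g" "dir_C1_on S w g"
  shows "((\<lambda>\<zeta>. g (x + Re \<zeta> *\<^sub>R v + Im \<zeta> *\<^sub>R w)) has_derivative
            (\<lambda>\<zeta>. Re \<zeta> *\<^sub>R dir_deriv v g x + Im \<zeta> *\<^sub>R dir_deriv w g x)) (at 0)"
proof -
  have "((\<lambda>(a, b). g (x + a *\<^sub>R v + b *\<^sub>R w)) \<circ> (\<lambda>\<zeta>. (Re \<zeta>, Im \<zeta>)) has_derivative
         (\<lambda>(a, b). a *\<^sub>R dir_deriv v g x + b *\<^sub>R dir_deriv w g x) \<circ> (\<lambda>\<zeta>. (Re \<zeta>, Im \<zeta>))) (at (0::complex))"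
  proof (rule diff_chain_at)
    show "((\<lambda>\<zeta>. (Re \<zeta>, Im \<zeta>)) has_derivative (\<lambda>\<zeta>. (Re \<zeta>, Im \<zeta>))) (at (0::complex))"
      by (intro has_derivative_Pair bounded_linear_imp_has_derivative bounded_linear_Re bounded_linear_Im)
  qed (use has_derivative_plane[OF assms] in simp)
  then show ?thesis
    by (simp add: o_def)
qed

text \<open>The Cauchy--Riemann criterion for a plane that is parametrised by a complex number.\<close>

lemma has_field_derivative_complex_plane:
  fixes g :: "'a::real_normed_vector \<Rightarrow> complex"
  assumes "open S" "x \<in> S" "dir_C1_on S v g" "dir_C1_on S w g"
    and CR: "dir_deriv w g x = \<i> * dir_deriv v g x"
  shows "((\<lambda>\<zeta>. g (x + Re \<zeta> *\<^sub>R v + Im \<zeta> *\<^sub>R w)) has_field_derivative dir_deriv v g x) (at 0)"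
proof -
  have "(\<lambda>\<zeta>. Re \<zeta> *\<^sub>R dir_deriv v g x + Im \<zeta> *\<^sub>R dir_deriv w g x) = (*) (dir_deriv v g x)"
    by (rule ext) (simp add: CR complex_eq_iff algebra_simps)
  then show ?thesis
    using has_derivative_complex_plane[OF assms(1-4)] by (simp add: has_field_derivative_def)
qed

lemma dir_deriv_commute:
  fixes g :: "'a::real_normed_vector \<Rightarrow> 'b::euclidean_space"
  assumes S: "open S" "x \<in> S" and v: "dir_C1_on S v g" and w: "dir_C1_on S w g"
    and vw: "dir_C1_on S v (dir_deriv w g)" and wv: "dir_C1_on S w (dir_deriv v g)"
  shows "dir_deriv w (dir_deriv v g) x = dir_deriv v (dir_deriv w g) x"
proof -
  define T where "T = (\<lambda>p::real \<times> real. x + fst p *\<^sub>R v + snd p *\<^sub>R w) -` S"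
  have "open T"
    unfolding T_def using S by (intro open_vimage continuous_intros) auto
  moreover have "(0, 0) \<in> T" using S by (simp add: T_def)
  ultimately obtain A B where AB: "open A" "open B" "(0,0) \<in> A \<times> B" "A \<times> B \<subseteq> T"
    by (elim open_prod_elim)
  then obtain c d where "c > 0" "cball 0 c \<subseteq> A" "d > 0" "cball 0 d \<subseteq> B"
    by (metis mem_Sigma_iff open_contains_cball)
  then have c: "c > 0" "{-c..c} \<subseteq> A" and d: "d > 0" "{-d..d} \<subseteq> B"
    by (auto simp: cball_eq_atLeastAtMost)
  have sub: "x + a *\<^sub>R v + b *\<^sub>R w \<in> S" if "a \<in> {-c..c}" "b \<in> {-d..d}" for a b
  proof -
    have "(a, b) \<in> A \<times> B" using that c d by auto
    then show ?thesis using AB(4) by (auto simp: T_def)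
  qed
  let ?gw = "\<lambda>a b. dir_deriv w g (x + a *\<^sub>R v + b *\<^sub>R w)"
  let ?gvw = "\<lambda>a b. dir_deriv v (dir_deriv w g) (x + a *\<^sub>R v + b *\<^sub>R w)"
  let ?gv = "\<lambda>b. dir_deriv v g (x + b *\<^sub>R w)"
  have cont: "continuous_on ({-c..c} \<times> {-d..d}) (\<lambda>(a, b). h (x + a *\<^sub>R v + b *\<^sub>R w))"
    if "continuous_on S h" for h :: "'a \<Rightarrow> 'b"
    unfolding case_prod_beta'
    by (intro continuous_on_compose2[OF that] continuous_intros) (use sub in auto)
  \<comment> \<open>The increment of \<open>g\<close> in the direction \<open>w\<close> is an integral; differentiating it in the direction \<open>v\<close>
    under the integral sign and then with respect to the upper limit exchanges the two derivatives.\<close>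
  have FTC: "(?gw a has_integral g (x + a *\<^sub>R v + b *\<^sub>R w) - g (x + a *\<^sub>R v + (-d) *\<^sub>R w)) {-d..b}"
    if "a \<in> {-c..c}" "b \<in> {-d..d}" for a b
    using that d sub
    by (intro fundamental_theorem_of_calculus has_vector_derivative_at_within[OF dir_deriv_along_line[OF w]])
       auto
  have eq: "integral {-d..b} (?gvw 0) = ?gv b - ?gv (-d)" if b: "b \<in> {-d..d}" for b
  proof -
    have "((\<lambda>a. integral (cbox (-d) b) (?gw a)) has_vector_derivative integral (cbox (-d) b) (?gvw 0)) (at 0 within {-c..c})"
    proof (rule leibniz_rule_vector_derivative)
      show "((\<lambda>a. ?gw a t) has_vector_derivative ?gvw a t) (at a within {-c..c})"
        if "a \<in> {-c..c}" "t \<in> cbox (-d) b" for a t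
        using dir_deriv_along_line[OF vw, of "x + t *\<^sub>R w" a] sub[of a t] b that
        by - (rule has_vector_derivative_at_within, simp add: add.commute add.left_commute)
      show "?gw a integrable_on cbox (-d) b" if "a \<in> {-c..c}" for a
        using FTC[OF that b] by auto
      show "continuous_on ({-c..c} \<times> cbox (-d) b) (\<lambda>(a, t). ?gvw a t)"
        using vw b unfolding dir_C1_on_def
        by (intro continuous_on_subset[OF cont[of "dir_deriv v (dir_deriv w g)"]]) auto
    qed (use c in auto)
    then have 1: "((\<lambda>a. g (x + a *\<^sub>R v + b *\<^sub>R w) - g (x + a *\<^sub>R v + (-d) *\<^sub>R w))
        has_vector_derivative integral {-d..b} (?gvw 0)) (at 0 within {-c..c})"
      unfolding cbox_interval
      by (rule has_vector_derivative_transform[rotated 2])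
         (use FTC[THEN integral_unique] b c in \<open>auto\<close>)
    have D: "((\<lambda>a. g (x + a *\<^sub>R v + t *\<^sub>R w)) has_vector_derivative ?gv t) (at 0 within {-c..c})"
      if "t \<in> {-d..d}" for t
      using dir_deriv_along_line[OF v, of "x + t *\<^sub>R w" 0] sub[of 0 t] that c
      by - (rule has_vector_derivative_at_within, simp add: add.commute add.left_commute)
    have "((\<lambda>a. g (x + a *\<^sub>R v + b *\<^sub>R w) - g (x + a *\<^sub>R v + (-d) *\<^sub>R w))
        has_vector_derivative ?gv b - ?gv (-d)) (at 0 within {-c..c})"
      using d b by (intro has_vector_derivative_diff D) auto
    with 1 show ?thesis
      using c vector_derivative_unique_within_closed_interval[of "-c" c 0] by simp
  qed
  have "continuous_on {-d..d} (?gvw 0)"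
    by (intro continuous_on_compose2[OF dir_C1_on_cont[OF vw]] continuous_intros) (use c sub[of 0] in auto)
  then have "((\<lambda>b. integral {-d..b} (?gvw 0)) has_vector_derivative ?gvw 0 0) (at 0 within {-d..d})"
    using d by (intro integral_has_vector_derivative) auto
  then have "((\<lambda>b. ?gv b - ?gv (-d)) has_vector_derivative ?gvw 0 0) (at 0 within {-d..d})"
    by (rule has_vector_derivative_transform[rotated 2]) (use eq d in auto)
  from has_vector_derivative_add[OF this has_vector_derivative_const[of "?gv (-d)"]]
  have "(?gv has_vector_derivative dir_deriv v (dir_deriv w g) x) (at 0 within {-d..d})"
    by simp
  moreover have "(?gv has_vector_derivative dir_deriv w (dir_deriv v g) x) (at 0 within {-d..d})"
    using wv S by (intro has_vector_derivative_at_within[OF dir_deriv_works]) (simp add: dir_C1_on_def)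
  ultimately show ?thesis
    using d vector_derivative_unique_within_closed_interval[of "-d" d 0] by simp
qed

section \<open>Harmonic functions on convex plane domains\<close>

lemma dir_C1_on_bounded_linear:
  fixes g :: "'a::real_normed_vector \<Rightarrow> 'b::real_normed_vector"
  assumes g: "dir_C1_on S v g" and L: "bounded_linear L"
  shows "dir_C1_on S v (\<lambda>x. L (g x))"
    and "\<And>x. x \<in> S \<Longrightarrow> dir_deriv v (\<lambda>x. L (g x)) x = L (dir_deriv v g x)"
proof -
  have D: "((\<lambda>t. L (g (x + t *\<^sub>R v))) has_vector_derivative L (dir_deriv v g x)) (at 0)" if "x \<in> S" for x
    using g that by (intro bounded_linear.has_vector_derivative[OF L] dir_deriv_works) (simp add: dir_C1_on_def)
  then show eq: "dir_deriv v (\<lambda>x. L (g x)) x = L (dir_deriv v g x)" if "x \<in> S" for x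
    using that by (intro dir_deriv_eqI)
  have "continuous_on S (\<lambda>x. L (dir_deriv v g x))"
    using dir_C1_on_cont[OF g] by (rule bounded_linear.continuous_on[OF L])
  then have "continuous_on S (dir_deriv v (\<lambda>x. L (g x)))"
    using eq by (simp cong: continuous_on_cong)
  with D show "dir_C1_on S v (\<lambda>x. L (g x))"
    by (auto simp: dir_C1_on_def intro: differentiableI_vector)
qed

lemma dir_C1_on_add:
  fixes f g :: "'a::real_normed_vector \<Rightarrow> 'b::real_normed_vector"
  assumes f: "dir_C1_on S v f" and g: "dir_C1_on S v g"
  shows "dir_C1_on S v (\<lambda>x. f x + g x)"
    and "\<And>x. x \<in> S \<Longrightarrow> dir_deriv v (\<lambda>x. f x + g x) x = dir_deriv v f x + dir_deriv v g x"
proof -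
  have D: "((\<lambda>t. f (x + t *\<^sub>R v) + g (x + t *\<^sub>R v)) has_vector_derivative dir_deriv v f x + dir_deriv v g x) (at 0)"
    if "x \<in> S" for x
    using f g that by (intro has_vector_derivative_add dir_deriv_works) (simp_all add: dir_C1_on_def)
  then show eq: "dir_deriv v (\<lambda>x. f x + g x) x = dir_deriv v f x + dir_deriv v g x" if "x \<in> S" for x
    using that by (intro dir_deriv_eqI)
  have "continuous_on S (\<lambda>x. dir_deriv v f x + dir_deriv v g x)"
    using dir_C1_on_cont[OF f] dir_C1_on_cont[OF g] by (rule continuous_on_add)
  then have "continuous_on S (dir_deriv v (\<lambda>x. f x + g x))"
    using eq by (simp cong: continuous_on_cong)
  with D show "dir_C1_on S v (\<lambda>x. f x + g x)"
    by (auto simp: dir_C1_on_def intro: differentiableI_vector)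
qed

text \<open>Vanishing divergence and curl of the field \<open>(p, q)\<close> are the Cauchy--Riemann equations of \<open>p - \<i> q\<close>.\<close>

lemma holomorphic_on_conjugate_gradient:
  fixes p q :: "complex \<Rightarrow> complex"
  assumes S: "open S"
    and p: "dir_C1_on S 1 p" "dir_C1_on S \<i> p" and q: "dir_C1_on S 1 q" "dir_C1_on S \<i> q"
    and div: "\<And>z. z \<in> S \<Longrightarrow> dir_deriv 1 p z + dir_deriv \<i> q z = 0"
    and curl: "\<And>z. z \<in> S \<Longrightarrow> dir_deriv \<i> p z = dir_deriv 1 q z"
  shows "(\<lambda>z. p z - \<i> * q z) holomorphic_on S"
proof -
  have L: "bounded_linear (\<lambda>z. - (\<i> * z))"
    by (intro bounded_linear_minus bounded_linear_mult_right)
  note q' = dir_C1_on_bounded_linear[OF q(1) L] dir_C1_on_bounded_linear[OF q(2) L]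
  define h where "h = (\<lambda>z. p z + - (\<i> * q z))"
  have h: "dir_C1_on S 1 h" "dir_C1_on S \<i> h"
    unfolding h_def by (intro dir_C1_on_add p q')+
  have "(h has_field_derivative dir_deriv 1 h z) (at z)" if z: "z \<in> S" for z
  proof -
    have eqs: "dir_deriv 1 h z = dir_deriv 1 p z - \<i> * dir_deriv 1 q z"
        "dir_deriv \<i> h z = dir_deriv 1 q z - \<i> * dir_deriv \<i> q z"
      unfolding h_def
      by (simp_all add: dir_C1_on_add(2)[OF p(1) q'(1) z] dir_C1_on_add(2)[OF p(2) q'(3) z]
          q'(2,4)[OF z] curl[OF z] del: add_uminus_conv_diff)
    have "dir_deriv \<i> q z = - dir_deriv 1 p z"
      using div[OF z] by (simp add: eq_neg_iff_add_eq_0 add.commute)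
    with eqs have "dir_deriv \<i> h z = dir_deriv 1 q z + \<i> * dir_deriv 1 p z"
      by simp
    then have CR: "dir_deriv \<i> h z = \<i> * dir_deriv 1 h z"
      unfolding eqs(1) by (simp add: right_diff_distrib)
    have arg: "z + Re \<zeta> *\<^sub>R 1 + Im \<zeta> *\<^sub>R \<i> = \<zeta> + z" for \<zeta>
      by (simp add: complex_eq_iff)
    from has_field_derivative_complex_plane[OF S z h CR]
    have "((\<lambda>\<zeta>. h (\<zeta> + z)) has_field_derivative dir_deriv 1 h z) (at 0)"
      unfolding arg .
    then show ?thesis
      using DERIV_shift[of h _ 0 z] by simp
  qed
  then have "h holomorphic_on S"
    using S by (auto simp: holomorphic_on_open)
  then show ?thesis by (simp add: h_def)
qed

text \<open>The conjugate gradient of a harmonic function is holomorphic, and so is that of its complex conjugate. Half of the sum of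
a primitive of the first and the conjugate of a primitive of the second has the same gradient as the given function.\<close>

lemma harmonic_on_decompose:
  assumes S: "open S" "convex S" and g: "harmonic_on S g"
  shows "\<exists>A B. A holomorphic_on S \<and> B holomorphic_on S \<and> (\<forall>z\<in>S. g z = A z + cnj (B z))"
proof (cases "S = {}")
  case False
  then obtain z0 where z0: "z0 \<in> S" by blast
  let ?x = "dir_deriv 1 g" and ?y = "dir_deriv \<i> g"
  have C: "dir_C1_on S 1 g" "dir_C1_on S \<i> g" "dir_C1_on S 1 ?x" "dir_C1_on S \<i> ?x"
      "dir_C1_on S 1 ?y" "dir_C1_on S \<i> ?y"
    using g unfolding harmonic_on_def cont_diff_on_def dir_C1_on_def Basis_complex_def by auto
  have lap: "dir_deriv 1 ?x z + dir_deriv \<i> ?y z = 0" if "z \<in> S" for z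
    using g that unfolding harmonic_on_def laplacian_def Basis_complex_def by simp
  have com: "dir_deriv \<i> ?x z = dir_deriv 1 ?y z" if "z \<in> S" for z
    using dir_deriv_commute[OF S(1) that C(1,2)] C by blast
  note cn = dir_C1_on_bounded_linear[OF _ bounded_linear_cnj]
  have "(\<lambda>z. ?x z - \<i> * ?y z) holomorphic_on S"
    by (intro holomorphic_on_conjugate_gradient S C lap com)
  then obtain A where A: "\<And>z. z \<in> S \<Longrightarrow> (A has_field_derivative ?x z - \<i> * ?y z) (at z within S)"
    using holomorphic_convex_primitive'[OF S(2) S(1)] by blast
  have "(\<lambda>z. cnj (?x z) - \<i> * cnj (?y z)) holomorphic_on S"
  proof (rule holomorphic_on_conjugate_gradient)
    show "dir_deriv 1 (\<lambda>x. cnj (?x x)) z + dir_deriv \<i> (\<lambda>x. cnj (?y x)) z = 0" if "z \<in> S" for z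
      using lap[OF that] by (simp add: cn(2)[OF C(3) that] cn(2)[OF C(6) that] flip: complex_cnj_add)
    show "dir_deriv \<i> (\<lambda>x. cnj (?x x)) z = dir_deriv 1 (\<lambda>x. cnj (?y x)) z" if "z \<in> S" for z
      using com[OF that] by (simp add: cn(2)[OF C(4) that] cn(2)[OF C(5) that])
  qed (intro S cn C)+
  then obtain B where B: "\<And>z. z \<in> S \<Longrightarrow> (B has_field_derivative cnj (?x z) - \<i> * cnj (?y z)) (at z within S)"
    using holomorphic_convex_primitive'[OF S(2) S(1)] by blast
  have "((\<lambda>z. g z - (A z + cnj (B z)) / 2) has_derivative (\<lambda>_. 0)) (at z within S)" if z: "z \<in> S" for z
  proof -
    have arg: "z + Re \<zeta> *\<^sub>R 1 + Im \<zeta> *\<^sub>R \<i> = z + \<zeta>" for \<zeta>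
      by (simp add: complex_eq_iff)
    have "((\<lambda>\<zeta>. g (z + \<zeta>)) has_derivative (\<lambda>\<zeta>. Re \<zeta> *\<^sub>R ?x z + Im \<zeta> *\<^sub>R ?y z)) (at 0)"
      using has_derivative_complex_plane[OF S(1) z C(1,2)]
      unfolding arg .
    then have "(g has_derivative (\<lambda>\<zeta>. Re \<zeta> *\<^sub>R ?x z + Im \<zeta> *\<^sub>R ?y z)) (at z within S)"
    proof -
      assume *: "((\<lambda>\<zeta>. g (z + \<zeta>)) has_derivative (\<lambda>\<zeta>. Re \<zeta> *\<^sub>R ?x z + Im \<zeta> *\<^sub>R ?y z)) (at 0)"
      have "((\<lambda>w. w - z) has_derivative (\<lambda>x. x)) (at z within S)"
        by (auto intro!: derivative_eq_intros)
      then show ?thesis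
        using has_derivative_compose[of "\<lambda>w. w - z" "\<lambda>x. x" z S "\<lambda>\<zeta>. g (z + \<zeta>)"] * by simp
    qed
    moreover have "(A has_derivative (*) (?x z - \<i> * ?y z)) (at z within S)"
      using A[OF z] by (simp add: has_field_derivative_def)
    moreover have "((\<lambda>z. cnj (B z)) has_derivative (\<lambda>\<zeta>. cnj ((cnj (?x z) - \<i> * cnj (?y z)) * \<zeta>))) (at z within S)"
      using B[OF z] by (intro bounded_linear.has_derivative[OF bounded_linear_cnj]) (simp add: has_field_derivative_def)
    ultimately have "((\<lambda>z. g z - (A z + cnj (B z)) * (1/2)) has_derivative
        (\<lambda>\<zeta>. (Re \<zeta> *\<^sub>R ?x z + Im \<zeta> *\<^sub>R ?y z) -
          ((?x z - \<i> * ?y z) * \<zeta> + cnj ((cnj (?x z) - \<i> * cnj (?y z)) * \<zeta>)) * (1/2))) (at z within S)"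
      by (intro has_derivative_diff has_derivative_add has_derivative_mult_left)
    note D = this
    have "(?x z - \<i> * ?y z) * \<zeta> + cnj ((cnj (?x z) - \<i> * cnj (?y z)) * \<zeta>)
        = (Re \<zeta> *\<^sub>R ?x z + Im \<zeta> *\<^sub>R ?y z) * 2" for \<zeta>
      by (simp add: complex_eq_iff algebra_simps)
    then have zero: "(Re \<zeta> *\<^sub>R ?x z + Im \<zeta> *\<^sub>R ?y z) -
          ((?x z - \<i> * ?y z) * \<zeta> + cnj ((cnj (?x z) - \<i> * cnj (?y z)) * \<zeta>)) * (1/2) = 0" for \<zeta>
      by simp
    show ?thesis using D unfolding zero by simp
  qed
  from has_derivative_zero_constant[OF S(2) this]
  obtain c where c: "\<And>z. z \<in> S \<Longrightarrow> g z - (A z + cnj (B z)) / 2 = c"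
    by blast
  have hol: "A holomorphic_on S" "B holomorphic_on S"
    by (simp_all only: holomorphic_on_def field_differentiable_def) (intro ballI exI, erule A, intro ballI exI, erule B)
  have "(\<lambda>z. A z / 2 + c) holomorphic_on S \<and> (\<lambda>z. B z / 2) holomorphic_on S"
    using hol by (simp_all add: holomorphic_on_add holomorphic_on_divide)
  moreover have "g z = (A z / 2 + c) + cnj (B z / 2)" if "z \<in> S" for z
    by (simp add: c[OF that, symmetric] add_divide_distrib)
  ultimately show ?thesis
    by (intro exI[of _ "\<lambda>z. A z / 2 + c"] exI[of _ "\<lambda>z. B z / 2"]) simp
qed (auto simp: holomorphic_on_def)

text \<open>Of the two exponentials in \<open>cos t\<close>, one turns the integral into the Cauchy formula for the derivative at the centre
and the other one into the integral of a holomorphic function over a closed curve. The cosine, unlike a single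
exponential, treats a function and its complex conjugate alike.\<close>

lemma has_integral_circle_cos:
  fixes A :: "complex \<Rightarrow> complex"
  assumes A: "A holomorphic_on ball 0 d" and r: "0 < r" "r < d"
  shows "((\<lambda>t. A (of_real r * cis t) * cos t) has_integral pi * r * deriv A 0) {0..2*pi}"
proof -
  have sub: "cball 0 r \<subseteq> ball (0::complex) d" using r by auto
  have c: "continuous_on (cball 0 r) A" "A holomorphic_on ball 0 r"
    using holomorphic_on_subset[OF A sub] holomorphic_on_subset[OF A, of "ball 0 r"] r
    by (auto intro: holomorphic_on_imp_continuous_on)
  have "((\<lambda>u. A u / (u - 0) ^ Suc 1) has_contour_integral (2 * pi * \<i>) / fact 1 * (deriv ^^ 1) A 0) (circlepath 0 r)"
    using r c by (intro Cauchy_has_contour_integral_higher_derivative_circlepath) auto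
  then have 1: "((\<lambda>t. A (of_real r * cis t) / (of_real r * cis t)\<^sup>2 * of_real r * \<i> * cis t) has_integral
      2 * pi * \<i> * deriv A 0) {0..2*pi}"
    unfolding circlepath_def
    by (subst (asm) has_contour_integral_part_circlepath_iff) (simp_all add: power2_eq_square)
  have "((\<lambda>t. (r / \<i>) * (A (of_real r * cis t) / (of_real r * cis t)\<^sup>2 * of_real r * \<i> * cis t)) has_integral
      (r / \<i>) * (2 * pi * \<i> * deriv A 0)) {0..2*pi}"
    using 1 by (rule has_integral_mult_right)
  moreover have "(r / \<i>) * (A (of_real r * cis t) / (of_real r * cis t)\<^sup>2 * of_real r * \<i> * cis t)
      = A (of_real r * cis t) * cnj (cis t)" for t
    using r by (simp add: cis_cnj power2_eq_square field_simps) (simp add: cis_mult)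
  ultimately have I1: "((\<lambda>t. A (of_real r * cis t) * cnj (cis t)) has_integral 2 * pi * r * deriv A 0) {0..2*pi}"
    by (simp add: mult_ac)
  have "(A has_contour_integral 0) (circlepath 0 r)"
    using r A by (intro Cauchy_theorem_disc_simple[of _ 0 d]) auto
  then have "((\<lambda>t. A (of_real r * cis t) * of_real r * \<i> * cis t) has_integral 0) {0..2*pi}"
    unfolding circlepath_def
    by (subst (asm) has_contour_integral_part_circlepath_iff) simp_all
  then have *: "((\<lambda>t. (1 / (r * \<i>)) * (A (of_real r * cis t) * of_real r * \<i> * cis t)) has_integral
      (1 / (r * \<i>)) * 0) {0..2*pi}"
    by (rule has_integral_mult_right)
  have I2: "((\<lambda>t. A (of_real r * cis t) * cis t) has_integral 0) {0..2*pi}"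
  proof -
    have "(1 / (r * \<i>)) * (A (of_real r * cis t) * of_real r * \<i> * cis t) = A (of_real r * cis t) * cis t" for t
      using r by (simp add: field_simps)
    with * show ?thesis by simp
  qed
  have "((\<lambda>t. (1/2) * (A (of_real r * cis t) * cnj (cis t) + A (of_real r * cis t) * cis t)) has_integral
      (1/2) * (2 * pi * r * deriv A 0 + 0)) {0..2*pi}"
    by (intro has_integral_mult_right has_integral_add I1 I2)
  moreover have "(1/2) * (A (of_real r * cis t) * cnj (cis t) + A (of_real r * cis t) * cis t) =
      A (of_real r * cis t) * cos t" for t
    by (simp add: complex_eq_iff field_simps)
  ultimately show ?thesis by (simp add: mult.assoc)
qed

section \<open>Smoothness of functions that are harmonic on complex lines\<close>

text \<open>Pluriharmonicity in the form that is used below: on discs in complex lines the function is the sum of a holomorphic and an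
antiholomorphic function. The direction \<open>v\<close> is not normalised, and this property passes at once to linear combinations
and to complex conjugates.\<close>

definition slice_harmonic_on :: "(complex^'n) set \<Rightarrow> (complex^'n \<Rightarrow> complex) \<Rightarrow> bool" where
  "slice_harmonic_on S \<phi> \<longleftrightarrow> continuous_on S \<phi> \<and>
     (\<forall>z v. \<forall>d>0. ball z (d * norm v) \<subseteq> S \<longrightarrow>
        (\<exists>A B. A holomorphic_on ball 0 d \<and> B holomorphic_on ball 0 d \<and>
          (\<forall>\<zeta>\<in>ball 0 d. \<phi> (z + \<zeta> *s v) = A \<zeta> + cnj (B \<zeta>))))"

lemma norm_vector_smult_complex: "norm (c *s (v::complex^'n)) = cmod c * norm v"
  by (simp add: norm_vec_def L2_set_def norm_mult power_mult_distrib real_sqrt_mult flip: sum_distrib_left)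

lemma vector_smult_of_real: "of_real t *s (v::complex^'n) = t *\<^sub>R v"
  by (simp add: vec_eq_iff scaleR_conv_of_real[where 'a=complex])

lemma bounded_linear_smult_left: "bounded_linear (\<lambda>c. c *s (v::complex^'n))"
  by (rule bounded_linear_intro[of _ "norm v"])
     (simp_all add: vec_eq_iff algebra_simps norm_vector_smult_complex)

lemma continuous_on_smult [continuous_intros]:
  fixes v :: "complex^'n"
  shows "continuous_on S f \<Longrightarrow> continuous_on S (\<lambda>x. f x *s v)"
  by (rule bounded_linear.continuous_on[OF bounded_linear_smult_left])

lemma slice_harmonic_on_if_pluriharmonic_on:
  fixes \<phi> :: "complex^'n \<Rightarrow> complex"
  assumes S: "open S" and \<phi>: "pluriharmonic_on S \<phi>"
  shows "slice_harmonic_on S \<phi>"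
  unfolding slice_harmonic_on_def
proof (intro conjI allI impI)
  show "continuous_on S \<phi>" using \<phi> by (simp add: pluriharmonic_on_def)
  fix z v :: "complex^'n" and d :: real
  assume d: "0 < d" and sub: "ball z (d * norm v) \<subseteq> S"
  show "\<exists>A B. A holomorphic_on ball 0 d \<and> B holomorphic_on ball 0 d \<and>
          (\<forall>\<zeta>\<in>ball 0 d. \<phi> (z + \<zeta> *s v) = A \<zeta> + cnj (B \<zeta>))"
  proof (cases "v = 0")
    case True
    then show ?thesis
      by (intro exI[of _ "\<lambda>_. \<phi> z"] exI[of _ "\<lambda>_. 0"]) simp
  next
    case False
    define r where "r = d * norm v"
    have r: "r > 0" using d False by (simp add: r_def)
    define \<theta> where "\<theta> = (1 / norm v) *\<^sub>R v"
    have \<theta>: "\<theta> \<in> sphere 0 1" using False by (simp add: \<theta>_def)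
    have z: "z \<in> S" using sub r by (auto simp: r_def)
    have "ereal r \<le> boundary_dist S z"
      unfolding boundary_dist_def
    proof (rule INF_greatest)
      fix w assume "w \<in> frontier S"
      then have "w \<notin> S" using S by (simp add: frontier_def interior_open)
      then have "w \<notin> ball z r" using sub by (auto simp: r_def)
      then show "ereal r \<le> ereal (dist z w)" by simp
    qed
    then have disc: "ball 0 r \<subseteq> {\<zeta>. ereal (cmod \<zeta>) < boundary_dist S z}"
      using less_le_trans[of "ereal (cmod _)" "ereal r"] by auto
    have "harmonic_on {\<zeta>. ereal (cmod \<zeta>) < boundary_dist S z} (\<lambda>\<zeta>. \<phi> (z + \<zeta> *s \<theta>))"
      using \<phi> z \<theta> by (auto simp: pluriharmonic_on_def)
    then have "harmonic_on (ball 0 r) (\<lambda>\<zeta>. \<phi> (z + \<zeta> *s \<theta>))"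
      using disc unfolding harmonic_on_def cont_diff_on_def
      by (meson continuous_on_subset subsetD)
    from harmonic_on_decompose[OF _ _ this]
    obtain A B where AB: "A holomorphic_on ball 0 r" "B holomorphic_on ball 0 r"
      "\<And>\<zeta>. \<zeta> \<in> ball 0 r \<Longrightarrow> \<phi> (z + \<zeta> *s \<theta>) = A \<zeta> + cnj (B \<zeta>)" by auto
    have scale: "of_real (norm v) * \<zeta> \<in> ball 0 r" if "\<zeta> \<in> ball 0 d" for \<zeta> :: complex
      using that False by (simp add: r_def norm_mult)
    have arg: "(of_real (norm v) * \<zeta>) *s \<theta> = \<zeta> *s v" for \<zeta>
      using False by (simp add: \<theta>_def vec_eq_iff scaleR_conv_of_real[where 'a=complex])
    have "(A \<circ> (\<lambda>\<zeta>. of_real (norm v) * \<zeta>)) holomorphic_on ball 0 d"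
         "(B \<circ> (\<lambda>\<zeta>. of_real (norm v) * \<zeta>)) holomorphic_on ball 0 d"
      using AB scale by (auto intro!: holomorphic_on_compose_gen[of _ _ _ "ball 0 r"] holomorphic_intros)
    moreover have "\<phi> (z + \<zeta> *s v) = A (of_real (norm v) * \<zeta>) + cnj (B (of_real (norm v) * \<zeta>))"
      if "\<zeta> \<in> ball 0 d" for \<zeta>
      using AB(3)[OF scale[OF that]] by (simp add: arg)
    ultimately show ?thesis
      by (intro exI[of _ "A \<circ> (\<lambda>\<zeta>. of_real (norm v) * \<zeta>)"] exI[of _ "B \<circ> (\<lambda>\<zeta>. of_real (norm v) * \<zeta>)"]) simp
  qed
qed

text \<open>The \<open>\<partial>\<close>-part of the derivative in the direction \<open>v\<close>: on a complex line with direction \<open>v\<close>, where the function is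
\<open>A + cnj B\<close>, it is the derivative of \<open>A\<close>.\<close>

definition dz_slice :: "complex^'n \<Rightarrow> (complex^'n \<Rightarrow> complex) \<Rightarrow> complex^'n \<Rightarrow> complex" where
  "dz_slice v \<phi> z = (dir_deriv v \<phi> z - \<i> * dir_deriv (\<i> *s v) \<phi> z) / 2"

lemma dir_deriv_slice:
  fixes \<phi> :: "complex^'n \<Rightarrow> complex"
  assumes A: "A holomorphic_on ball 0 d" and B: "B holomorphic_on ball 0 d"
    and eq: "\<And>\<zeta>. \<zeta> \<in> ball 0 d \<Longrightarrow> \<phi> (z + \<zeta> *s v) = A \<zeta> + cnj (B \<zeta>)"
    and \<zeta>: "\<zeta> \<in> ball 0 d"
  shows "((\<lambda>t. \<phi> (z + \<zeta> *s v + t *\<^sub>R (c *s v))) has_vector_derivative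
           deriv A \<zeta> * c + cnj (deriv B \<zeta> * c)) (at 0)"
proof -
  have lin: "((\<lambda>t. \<zeta> + of_real t * c) has_vector_derivative c) (at (0::real))"
    by (auto intro!: derivative_eq_intros simp: has_vector_derivative_def scaleR_conv_of_real)
  have "((\<lambda>t. A (\<zeta> + of_real t * c)) has_vector_derivative c * deriv A \<zeta>) (at 0)"
    using field_vector_diff_chain_at[OF lin, of A "deriv A \<zeta>"] holomorphic_derivI[OF A _ \<zeta>]
    by (simp add: o_def)
  moreover have "((\<lambda>t. B (\<zeta> + of_real t * c)) has_vector_derivative c * deriv B \<zeta>) (at 0)"
    using field_vector_diff_chain_at[OF lin, of B "deriv B \<zeta>"] holomorphic_derivI[OF B _ \<zeta>]
    by (simp add: o_def)
  ultimately have D: "((\<lambda>t. A (\<zeta> + of_real t * c) + cnj (B (\<zeta> + of_real t * c))) has_vector_derivative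
      c * deriv A \<zeta> + cnj (c * deriv B \<zeta>)) (at 0)"
    by (intro has_vector_derivative_add has_vector_derivative_cnj)
  have "((\<lambda>t. \<phi> (z + \<zeta> *s v + t *\<^sub>R (c *s v))) has_vector_derivative
      c * deriv A \<zeta> + cnj (c * deriv B \<zeta>)) (at 0)"
  proof (rule has_vector_derivative_transform_within_open[OF D])
    show "open ((\<lambda>t::real. \<zeta> + of_real t * c) -` ball 0 d)"
      by (intro open_vimage continuous_intros) auto
    fix t assume t: "t \<in> (\<lambda>t::real. \<zeta> + of_real t * c) -` ball 0 d"
    have arg: "z + \<zeta> *s v + t *\<^sub>R (c *s v) = z + (\<zeta> + of_real t * c) *s v"
      by (simp add: vec_eq_iff scaleR_conv_of_real[where 'a=complex] algebra_simps)
    show "A (\<zeta> + of_real t * c) + cnj (B (\<zeta> + of_real t * c)) = \<phi> (z + \<zeta> *s v + t *\<^sub>R (c *s v))"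
      unfolding arg using eq[of "\<zeta> + of_real t * c"] t by simp
  qed (use \<zeta> in auto)
  then show ?thesis by (simp add: mult.commute)
qed

lemma slice_harmonic_onD:
  fixes \<phi> :: "complex^'n \<Rightarrow> complex"
  assumes "slice_harmonic_on S \<phi>" "0 < d" "ball z (d * norm v) \<subseteq> S"
  obtains A B where "A holomorphic_on ball 0 d" "B holomorphic_on ball 0 d"
    "\<And>\<zeta>. \<zeta> \<in> ball 0 d \<Longrightarrow> \<phi> (z + \<zeta> *s v) = A \<zeta> + cnj (B \<zeta>)"
  using assms unfolding slice_harmonic_on_def by blast

text \<open>A derivative is expressed by values of the function on a circle. Together with the continuity of the
function this gives continuity of the derivative in the base point, and differentiation under the integral sign gives
second derivatives, although the definition only speaks about one complex line at a time.\<close>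

lemma dir_deriv_circle:
  fixes \<phi> :: "complex^'n \<Rightarrow> complex"
  assumes \<phi>: "slice_harmonic_on S \<phi>" and r: "0 < r" "r < d" and sub: "ball z (d * norm v) \<subseteq> S"
  shows "(\<lambda>t. \<phi> (z + t *\<^sub>R v)) differentiable (at 0)"
    and "dir_deriv v \<phi> z =
      of_real (1 / (pi * r)) * integral (cbox 0 (2*pi)) (\<lambda>t. \<phi> (z + (of_real r * cis t) *s v) * of_real (cos t))"
proof -
  obtain A B where A: "A holomorphic_on ball 0 d" and B: "B holomorphic_on ball 0 d"
    and eq: "\<And>\<zeta>. \<zeta> \<in> ball 0 d \<Longrightarrow> \<phi> (z + \<zeta> *s v) = A \<zeta> + cnj (B \<zeta>)"
    using slice_harmonic_onD[OF \<phi> _ sub] r by auto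
  have D: "((\<lambda>t. \<phi> (z + t *\<^sub>R v)) has_vector_derivative deriv A 0 + cnj (deriv B 0)) (at 0)"
    using dir_deriv_slice[OF A B eq, of 0 1] r by simp
  then show "(\<lambda>t. \<phi> (z + t *\<^sub>R v)) differentiable (at 0)"
    by (rule differentiableI_vector)
  have "((\<lambda>t. A (of_real r * cis t) * of_real (cos t) + cnj (B (of_real r * cis t) * of_real (cos t)))
      has_integral pi * r * deriv A 0 + cnj (pi * r * deriv B 0)) {0..2*pi}"
    by (intro has_integral_add has_integral_circle_cos[OF A r]
        has_integral_cnj[THEN iffD2, unfolded o_def] has_integral_circle_cos[OF B r])
  moreover have "A (of_real r * cis t) * of_real (cos t) + cnj (B (of_real r * cis t) * of_real (cos t)) =
      \<phi> (z + (of_real r * cis t) *s v) * of_real (cos t)" for t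
    using eq[of "of_real r * cis t"] r by (simp add: norm_mult distrib_right)
  ultimately have "((\<lambda>t. \<phi> (z + (of_real r * cis t) *s v) * of_real (cos t))
      has_integral of_real (pi * r) * (deriv A 0 + cnj (deriv B 0))) (cbox 0 (2*pi))"
    by (simp add: algebra_simps)
  then have "integral (cbox 0 (2*pi)) (\<lambda>t. \<phi> (z + (of_real r * cis t) *s v) * of_real (cos t)) =
      of_real (pi * r) * (deriv A 0 + cnj (deriv B 0))"
    by (rule integral_unique)
  then show "dir_deriv v \<phi> z =
      of_real (1 / (pi * r)) * integral (cbox 0 (2*pi)) (\<lambda>t. \<phi> (z + (of_real r * cis t) *s v) * of_real (cos t))"
    using dir_deriv_eqI[OF D] r by (simp add: field_simps)
qed

lemma dir_C1_on_transfer: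
  fixes f g :: "'a::real_normed_vector \<Rightarrow> 'b::real_normed_vector"
  assumes T: "open T" and f: "dir_C1_on T v f" and eq: "\<And>x. x \<in> T \<Longrightarrow> f x = g x"
  shows "dir_C1_on T v g"
proof -
  have D: "((\<lambda>t. g (x + t *\<^sub>R v)) has_vector_derivative dir_deriv v f x) (at 0)" if x: "x \<in> T" for x
  proof (rule has_vector_derivative_transform_within_open)
    show "((\<lambda>t. f (x + t *\<^sub>R v)) has_vector_derivative dir_deriv v f x) (at 0)"
      using f x by (intro dir_deriv_works) (simp add: dir_C1_on_def)
    show "open ((\<lambda>t. x + t *\<^sub>R v) -` T)"
      using T by (intro open_vimage continuous_intros) auto
  qed (use x eq in auto)
  then have "dir_deriv v g x = dir_deriv v f x" if "x \<in> T" for x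
    using that by (intro dir_deriv_eqI)
  then have "continuous_on T (dir_deriv v g)"
    using dir_C1_on_cont[OF f] by (simp cong: continuous_on_cong)
  with D show ?thesis
    by (auto simp: dir_C1_on_def intro: differentiableI_vector)
qed

lemma dir_C1_on_locally:
  fixes g :: "'a::real_normed_vector \<Rightarrow> 'b::real_normed_vector"
  assumes "\<And>x. x \<in> S \<Longrightarrow> \<exists>T. open T \<and> x \<in> T \<and> dir_C1_on T v g"
  shows "dir_C1_on S v g"
proof -
  have "(\<lambda>t. g (x + t *\<^sub>R v)) differentiable (at 0) \<and> isCont (dir_deriv v g) x" if "x \<in> S" for x
    using assms[OF that] unfolding dir_C1_on_def by (auto simp: continuous_on_eq_continuous_at)
  then show ?thesis
    unfolding dir_C1_on_def by (auto intro: continuous_at_imp_continuous_on)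
qed

lemma continuous_on_circle_integral:
  fixes \<psi> :: "complex^'n \<Rightarrow> complex"
  assumes \<psi>: "continuous_on S \<psi>"
    and sub: "\<And>z t. z \<in> T \<Longrightarrow> z + (of_real r * cis t) *s v \<in> S"
  shows "continuous_on T (\<lambda>z. c * integral (cbox 0 (2*pi)) (\<lambda>t. \<psi> (z + (of_real r * cis t) *s v) * of_real (cos t)))"
proof -
  have "continuous_on (T \<times> cbox 0 (2*pi)) (\<lambda>p. \<psi> (fst p + (of_real r * cis (snd p)) *s v) * of_real (cos (snd p)))"
    by (intro continuous_intros continuous_on_compose2[OF \<psi>]) (use sub in auto)
  then show ?thesis
    by (intro continuous_intros integral_continuous_on_param) (simp add: case_prod_beta')
qed

lemma dir_C1_on_circle_integral:
  fixes \<psi> :: "complex^'n \<Rightarrow> complex"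
  assumes T: "open T" and \<psi>: "continuous_on S \<psi>" "dir_C1_on S w \<psi>"
    and sub: "\<And>z t. z \<in> T \<Longrightarrow> z + (of_real r * cis t) *s v \<in> S"
  shows "dir_C1_on T w (\<lambda>z. c * integral (cbox 0 (2*pi)) (\<lambda>t. \<psi> (z + (of_real r * cis t) *s v) * of_real (cos t)))"
    (is "dir_C1_on T w (\<lambda>z. c * ?I \<psi> z)")
proof -
  have D: "((\<lambda>s. c * ?I \<psi> (z + s *\<^sub>R w)) has_vector_derivative c * ?I (dir_deriv w \<psi>) z) (at 0)"
    if z: "z \<in> T" for z
  proof -
    define U where "U = (\<lambda>s::real. z + s *\<^sub>R w) -` T"
    have "open U" unfolding U_def using T by (intro open_vimage continuous_intros) auto
    moreover have "0 \<in> U" using z by (simp add: U_def)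
    ultimately obtain e where e: "e > 0" "ball 0 e \<subseteq> U" by (meson open_contains_ball)
    define V where "V = ball (0::real) e"
    have VS: "z + s *\<^sub>R w + (of_real r * cis t) *s v \<in> S" if "s \<in> V" for s t
      using that e by (intro sub) (auto simp: V_def U_def)
    have "((\<lambda>s. ?I \<psi> (z + s *\<^sub>R w)) has_vector_derivative ?I (dir_deriv w \<psi>) (z + 0 *\<^sub>R w)) (at 0 within V)"
    proof (rule leibniz_rule_vector_derivative)
      fix s t assume s: "s \<in> V"
      have "((\<lambda>s. \<psi> (z + (of_real r * cis t) *s v + s *\<^sub>R w)) has_vector_derivative
          dir_deriv w \<psi> (z + (of_real r * cis t) *s v + s *\<^sub>R w)) (at s)"
        using VS[OF s, of t] by (intro dir_deriv_along_line[OF \<psi>(2)]) (simp add: add_ac)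
      then have "((\<lambda>s. \<psi> (z + s *\<^sub>R w + (of_real r * cis t) *s v)) has_vector_derivative
          dir_deriv w \<psi> (z + s *\<^sub>R w + (of_real r * cis t) *s v)) (at s within V)"
        by (intro has_vector_derivative_at_within[of _ _ _ V]) (simp add: add_ac)
      then show "((\<lambda>s. \<psi> (z + s *\<^sub>R w + (of_real r * cis t) *s v) * of_real (cos t)) has_vector_derivative
          dir_deriv w \<psi> (z + s *\<^sub>R w + (of_real r * cis t) *s v) * of_real (cos t)) (at s within V)"
        by (rule has_vector_derivative_mult_left)
    next
      fix s assume "s \<in> V"
      then show "(\<lambda>t. \<psi> (z + s *\<^sub>R w + (of_real r * cis t) *s v) * of_real (cos t)) integrable_on cbox 0 (2*pi)"
        by (intro integrable_continuous continuous_intros continuous_on_compose2[OF \<psi>(1)]) (use VS in auto)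
    next
      have "continuous_on (V \<times> cbox 0 (2*pi))
          (\<lambda>p. dir_deriv w \<psi> (z + fst p *\<^sub>R w + (of_real r * cis (snd p)) *s v) * of_real (cos (snd p)))"
        by (intro continuous_intros continuous_on_compose2[OF dir_C1_on_cont[OF \<psi>(2)]]) (use VS in auto)
      then show "continuous_on (V \<times> cbox 0 (2*pi))
          (\<lambda>(s, t). dir_deriv w \<psi> (z + s *\<^sub>R w + (of_real r * cis t) *s v) * of_real (cos t))"
        by (simp add: case_prod_beta')
    qed (use e in \<open>auto simp: V_def\<close>)
    moreover have "at 0 within V = at 0"
      using e by (intro at_within_open) (auto simp: V_def)
    ultimately show ?thesis
      by (intro has_vector_derivative_mult_right) simp
  qed
  then have "dir_deriv w (\<lambda>z. c * ?I \<psi> z) z = c * ?I (dir_deriv w \<psi>) z" if "z \<in> T" for z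
    using that by (intro dir_deriv_eqI)
  moreover have "continuous_on T (\<lambda>z. c * ?I (dir_deriv w \<psi>) z)"
    by (intro continuous_on_circle_integral[OF dir_C1_on_cont[OF \<psi>(2)]] sub)
  ultimately have "continuous_on T (dir_deriv w (\<lambda>z. c * ?I \<psi> z))"
    by (simp cong: continuous_on_cong)
  with D show ?thesis
    unfolding dir_C1_on_def by (blast intro: differentiableI_vector)
qed

lemma locally_dir_deriv_circle:
  fixes \<phi> :: "complex^'n \<Rightarrow> complex"
  assumes S: "open S" and \<phi>: "slice_harmonic_on S \<phi>" and z0: "z0 \<in> S"
  obtains T r where "open T" "z0 \<in> T" "T \<subseteq> S"
    "\<And>z t. z \<in> T \<Longrightarrow> z + (of_real r * cis t) *s v \<in> S"
    "\<And>z. z \<in> T \<Longrightarrow> (\<lambda>t. \<phi> (z + t *\<^sub>R v)) differentiable (at 0)"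
    "\<And>z. z \<in> T \<Longrightarrow> dir_deriv v \<phi> z =
      of_real (1 / (pi * r)) * integral (cbox 0 (2*pi)) (\<lambda>t. \<phi> (z + (of_real r * cis t) *s v) * of_real (cos t))"
proof -
  obtain e where e: "e > 0" "ball z0 e \<subseteq> S" using S z0 by (meson open_contains_ball)
  define d where "d = (e/2) / (norm v + 1)"
  have pos: "0 < norm v + 1" by (simp add: add_nonneg_pos)
  then have d: "d > 0" "d * norm v \<le> e/2"
    using e by (auto simp: d_def divide_simps)
  have sub: "ball z (d * norm v) \<subseteq> S" if "z \<in> ball z0 (e/2)" for z
  proof
    fix x assume "x \<in> ball z (d * norm v)"
    then have "dist z0 x < e"
      using that d dist_triangle[of z0 x z] by auto
    then show "x \<in> S" using e by auto
  qed
  show thesis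
  proof
    show "z + (of_real (d/2) * cis t) *s v \<in> S" if z: "z \<in> ball z0 (e/2)" for z t
    proof (cases "v = 0")
      case True
      have "z \<in> ball z0 e" using z e by auto
      then show ?thesis using True e by auto
    next
      case False
      then have "z + (of_real (d/2) * cis t) *s v \<in> ball z (d * norm v)"
        using d by (simp add: dist_norm norm_vector_smult_complex norm_mult)
      then show ?thesis using sub[OF z] by blast
    qed
    show "ball z0 (e/2) \<subseteq> S" using e by auto
    show "(\<lambda>t. \<phi> (z + t *\<^sub>R v)) differentiable (at 0)"
      "dir_deriv v \<phi> z = of_real (1 / (pi * (d/2))) *
        integral (cbox 0 (2*pi)) (\<lambda>t. \<phi> (z + (of_real (d/2) * cis t) *s v) * of_real (cos t))"
      if "z \<in> ball z0 (e/2)" for z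
      using dir_deriv_circle[OF \<phi> _ _ sub[OF that], of "d/2"] d by auto
  qed (use e in auto)
qed

lemma slice_harmonic_on_dir_C1:
  fixes \<phi> :: "complex^'n \<Rightarrow> complex"
  assumes S: "open S" and \<phi>: "slice_harmonic_on S \<phi>"
  shows "dir_C1_on S v \<phi>"
proof (rule dir_C1_on_locally)
  fix z0 assume "z0 \<in> S"
  show "\<exists>T. open T \<and> z0 \<in> T \<and> dir_C1_on T v \<phi>"
  proof (rule locally_dir_deriv_circle[OF S \<phi> \<open>z0 \<in> S\<close>, of v])
    fix T r assume T: "open T" "z0 \<in> T"
      and sub: "\<And>z t. z \<in> T \<Longrightarrow> z + (of_real r * cis t) *s v \<in> S"
      and diff: "\<And>z. z \<in> T \<Longrightarrow> (\<lambda>t. \<phi> (z + t *\<^sub>R v)) differentiable (at 0)"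
      and eq: "\<And>z. z \<in> T \<Longrightarrow> dir_deriv v \<phi> z =
        of_real (1 / (pi * r)) * integral (cbox 0 (2*pi)) (\<lambda>t. \<phi> (z + (of_real r * cis t) *s v) * of_real (cos t))"
    have "continuous_on T (dir_deriv v \<phi>)"
    proof (rule continuous_on_eq)
      have "continuous_on S \<phi>" using \<phi> by (simp add: slice_harmonic_on_def)
      then show "continuous_on T (\<lambda>z. of_real (1 / (pi * r)) *
          integral (cbox 0 (2*pi)) (\<lambda>t. \<phi> (z + (of_real r * cis t) *s v) * of_real (cos t)))"
        by (rule continuous_on_circle_integral[OF _ sub])
    qed (rule eq[symmetric])
    with T diff show "\<exists>T. open T \<and> z0 \<in> T \<and> dir_C1_on T v \<phi>"
      by (auto simp: dir_C1_on_def)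
  qed
qed

lemma slice_harmonic_on_dir_C2:
  fixes \<phi> :: "complex^'n \<Rightarrow> complex"
  assumes S: "open S" and \<phi>: "slice_harmonic_on S \<phi>"
  shows "dir_C1_on S w (dir_deriv v \<phi>)"
proof (rule dir_C1_on_locally)
  fix z0 assume "z0 \<in> S"
  show "\<exists>T. open T \<and> z0 \<in> T \<and> dir_C1_on T w (dir_deriv v \<phi>)"
  proof (rule locally_dir_deriv_circle[OF S \<phi> \<open>z0 \<in> S\<close>, of v])
    fix T r assume T: "open T" "z0 \<in> T"
      and sub: "\<And>z t. z \<in> T \<Longrightarrow> z + (of_real r * cis t) *s v \<in> S"
      and diff: "\<And>z. z \<in> T \<Longrightarrow> (\<lambda>t. \<phi> (z + t *\<^sub>R v)) differentiable (at 0)"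
      and eq: "\<And>z. z \<in> T \<Longrightarrow> dir_deriv v \<phi> z =
        of_real (1 / (pi * r)) * integral (cbox 0 (2*pi)) (\<lambda>t. \<phi> (z + (of_real r * cis t) *s v) * of_real (cos t))"
    have "continuous_on S \<phi>" using \<phi> by (simp add: slice_harmonic_on_def)
    from dir_C1_on_circle_integral[OF T(1) this slice_harmonic_on_dir_C1[OF S \<phi>] sub,
        where c="of_real (1 / (pi * r))"]
    have "dir_C1_on T w (dir_deriv v \<phi>)"
      by (rule dir_C1_on_transfer[OF T(1)]) (assumption, rule eq[symmetric])
    with T show "\<exists>T. open T \<and> z0 \<in> T \<and> dir_C1_on T w (dir_deriv v \<phi>)" by blast
  qed
qed

section \<open>The holomorphic part of the derivative\<close>

lemma dir_deriv_scaleR: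
  fixes g :: "'a::real_normed_vector \<Rightarrow> 'b::real_normed_vector"
  assumes "dir_C1_on S v g" "x \<in> S"
  shows "dir_deriv (c *\<^sub>R v) g x = c *\<^sub>R dir_deriv v g x"
proof (rule dir_deriv_eqI)
  have 1: "((\<lambda>t. t * c) has_vector_derivative c) (at (0::real))"
    by (auto intro!: derivative_eq_intros simp: has_vector_derivative_def)
  have 2: "((\<lambda>t. g (x + t *\<^sub>R v)) has_vector_derivative dir_deriv v g x) (at (0 * c))"
    using assms by (simp add: dir_deriv_works dir_C1_on_def)
  show "((\<lambda>t. g (x + t *\<^sub>R (c *\<^sub>R v))) has_vector_derivative c *\<^sub>R dir_deriv v g x) (at 0)"
    using vector_diff_chain_at[OF 1 2] by (simp add: o_def)
qed

lemma dir_deriv_additive: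
  fixes g :: "'a::real_normed_vector \<Rightarrow> 'b::real_normed_vector"
  assumes "open S" "x \<in> S" "dir_C1_on S v g" "dir_C1_on S w g"
  shows "dir_deriv (v + w) g x = dir_deriv v g x + dir_deriv w g x"
  by (rule dir_deriv_eqI[OF dir_deriv_add[OF assms]])

context
  fixes S :: "(complex^'n) set" and \<phi> :: "complex^'n \<Rightarrow> complex"
  assumes S: "open S" and \<phi>: "slice_harmonic_on S \<phi>"
begin

lemmas dir_C1 = slice_harmonic_on_dir_C1[OF S \<phi>]
lemmas dir_C2 = slice_harmonic_on_dir_C2[OF S \<phi>]

lemma dir_deriv2_commute:
  assumes "z \<in> S"
  shows "dir_deriv v (dir_deriv w \<phi>) z = dir_deriv w (dir_deriv v \<phi>) z"
  by (rule dir_deriv_commute[OF S assms dir_C1 dir_C1 dir_C2 dir_C2])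

lemma dir_deriv2_harmonic:
  assumes z: "z \<in> S"
  shows "dir_deriv v (dir_deriv v \<phi>) z + dir_deriv (\<i> *s v) (dir_deriv (\<i> *s v) \<phi>) z = 0"
proof -
  obtain e where e: "e > 0" "ball z e \<subseteq> S" using S z by (meson open_contains_ball)
  define d where "d = e / (norm v + 1)"
  have "0 < norm v + 1" by (simp add: add_nonneg_pos)
  then have d: "d > 0" "d * norm v \<le> e"
    using e by (auto simp: d_def divide_simps)
  then have sub: "ball z (d * norm v) \<subseteq> S" using e by force
  obtain A B where A: "A holomorphic_on ball 0 d" and B: "B holomorphic_on ball 0 d"
    and eq: "\<And>\<zeta>. \<zeta> \<in> ball 0 d \<Longrightarrow> \<phi> (z + \<zeta> *s v) = A \<zeta> + cnj (B \<zeta>)"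
    using slice_harmonic_onD[OF \<phi> d(1) sub] by metis
  have *: "dir_deriv (c *s v) (dir_deriv (c *s v) \<phi>) z =
      c\<^sup>2 * deriv (deriv A) 0 + cnj (c\<^sup>2 * deriv (deriv B) 0)" for c
  proof -
    have A': "(\<lambda>\<zeta>. deriv A \<zeta> * c) holomorphic_on ball 0 d" and B': "(\<lambda>\<zeta>. deriv B \<zeta> * c) holomorphic_on ball 0 d"
      using A B by (auto intro!: holomorphic_intros holomorphic_deriv)
    have eq': "dir_deriv (c *s v) \<phi> (z + \<zeta> *s v) = deriv A \<zeta> * c + cnj (deriv B \<zeta> * c)"
      if "\<zeta> \<in> ball 0 d" for \<zeta>
      by (rule dir_deriv_eqI[OF dir_deriv_slice[OF A B eq that]])
    have 0: "(0::complex) \<in> ball 0 d" using d by simp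
    have "deriv A field_differentiable at 0" "deriv B field_differentiable at 0"
      using holomorphic_deriv[OF A open_ball] holomorphic_deriv[OF B open_ball] 0
      by (auto intro: holomorphic_on_imp_differentiable_at[OF _ open_ball])
    then have "deriv (\<lambda>\<zeta>. deriv A \<zeta> * c) 0 = deriv (deriv A) 0 * c"
        "deriv (\<lambda>\<zeta>. deriv B \<zeta> * c) 0 = deriv (deriv B) 0 * c"
      by (simp_all add: deriv_cmult_right)
    then show ?thesis
      using dir_deriv_eqI[OF dir_deriv_slice[OF A' B' eq' 0], of c] by (simp add: power2_eq_square mult_ac)
  qed
  show ?thesis using *[of 1] *[of \<i>] by simp
qed

text \<open>The second derivative \<open>H\<close> is a symmetric bilinear form, and harmonicity on lines says \<open>H(\<i>v, \<i>v) = - H(v, v)\<close>.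
Polarisation turns this into a statement about two different directions, which carries information from
the line with direction \<open>v\<close> to lines in other directions.\<close>

lemma dir_deriv2_polarized:
  assumes z: "z \<in> S"
  shows "dir_deriv (\<i> *s v) (dir_deriv (\<i> *s w) \<phi>) z = - dir_deriv v (dir_deriv w \<phi>) z"
proof -
  define H where "H v w = dir_deriv v (dir_deriv w \<phi>) z" for v w
  have add: "H (a + b) w = H a w + H b w" for a b w
    unfolding H_def by (rule dir_deriv_additive[OF S z dir_C2 dir_C2])
  have com: "H a b = H b a" for a b unfolding H_def by (rule dir_deriv2_commute[OF z])
  have harm: "H (\<i> *s a) (\<i> *s a) = - H a a" for a
    using dir_deriv2_harmonic[OF z, of a] unfolding H_def by (simp add: eq_neg_iff_add_eq_0 add.commute)
  have expand: "H (a + b) (a + b) = H a a + H b b + 2 * H a b" for a b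
  proof -
    have "H (a + b) (a + b) = H (a + b) a + H (a + b) b"
      unfolding add[of a b "a + b"] com[of a "a + b"] com[of b "a + b"] ..
    also have "\<dots> = H a a + H b a + (H a b + H b b)" unfolding add ..
    finally show ?thesis by (simp add: com[of b a])
  qed
  have "\<i> *s (v + w) = \<i> *s v + \<i> *s w" by (simp add: vec_eq_iff algebra_simps)
  then have "H (\<i> *s v + \<i> *s w) (\<i> *s v + \<i> *s w) = - H (v + w) (v + w)"
    using harm[of "v + w"] by simp
  then have "2 * H (\<i> *s v) (\<i> *s w) = 2 * (- H v w)"
    unfolding expand harm by simp
  then have "H (\<i> *s v) (\<i> *s w) = - H v w"
    by (simp only: mult_cancel_left) simp
  then show ?thesis by (simp add: H_def)
qed

lemma dz_slice_dir_C1: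
  shows "dir_C1_on S w (dz_slice v \<phi>)"
    and "z \<in> S \<Longrightarrow> dir_deriv w (dz_slice v \<phi>) z =
      (dir_deriv w (dir_deriv v \<phi>) z - \<i> * dir_deriv w (dir_deriv (\<i> *s v) \<phi>) z) / 2"
proof -
  have L1: "bounded_linear (\<lambda>x::complex. (1/2) * x)" and L2: "bounded_linear (\<lambda>x::complex. (-\<i>/2) * x)"
    by (rule bounded_linear_mult_right)+
  note a = dir_C1_on_bounded_linear[OF dir_C2[of w v] L1]
  note b = dir_C1_on_bounded_linear[OF dir_C2[of w "\<i> *s v"] L2]
  have eq: "dz_slice v \<phi> = (\<lambda>x. (1/2) * dir_deriv v \<phi> x + (-\<i>/2) * dir_deriv (\<i> *s v) \<phi> x)"
    by (simp add: dz_slice_def fun_eq_iff field_simps)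
  show "dir_C1_on S w (dz_slice v \<phi>)"
    unfolding eq by (rule dir_C1_on_add(1)[OF a(1) b(1)])
  show "dir_deriv w (dz_slice v \<phi>) z =
      (dir_deriv w (dir_deriv v \<phi>) z - \<i> * dir_deriv w (dir_deriv (\<i> *s v) \<phi>) z) / 2" if "z \<in> S"
    unfolding eq dir_C1_on_add(2)[OF a(1) b(1) that] a(2)[OF that] b(2)[OF that] by (simp add: field_simps)
qed

text \<open>The Cauchy--Riemann equation in the direction \<open>\<theta>\<close> for the \<open>\<partial>\<close>-part in the direction \<open>v\<close> is the polarised identity for
the pairs \<open>(\<theta>, v)\<close> and \<open>(\<theta>, \<i>v)\<close>.\<close>

lemma dz_slice_holomorphic:
  "(\<lambda>\<zeta>. dz_slice v \<phi> (z + \<zeta> *s \<theta>)) holomorphic_on {\<zeta>. z + \<zeta> *s \<theta> \<in> S}"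
proof -
  have "open ((\<lambda>\<zeta>. z + \<zeta> *s \<theta>) -` S)"
    using S by (intro open_vimage continuous_intros) auto
  then have open_U: "open {\<zeta>. z + \<zeta> *s \<theta> \<in> S}" by (simp add: vimage_def)
  have "\<exists>D. ((\<lambda>\<zeta>. dz_slice v \<phi> (z + \<zeta> *s \<theta>)) has_field_derivative D) (at \<omega>)"
    if \<omega>: "z + \<omega> *s \<theta> \<in> S" for \<omega>
  proof -
    let ?x = "z + \<omega> *s \<theta>"
    define H where "H a b = dir_deriv a (dir_deriv b \<phi>) ?x" for a b
    have pol: "H (\<i> *s a) (\<i> *s b) = - H a b" for a b
      unfolding H_def by (rule dir_deriv2_polarized[OF \<omega>])
    have ii: "\<i> *s (\<i> *s a) = (-1) *\<^sub>R a" for a :: "complex^'n" by (simp add: vec_eq_iff)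
    have "H (\<i> *s \<theta>) v = - H (\<i> *s \<theta>) ((-1) *\<^sub>R v)"
      using dir_deriv_scaleR[OF dir_C2 \<omega>, of "-1" v "\<i> *s \<theta>"] dir_deriv2_commute[OF \<omega>]
      by (simp add: H_def)
    also have "\<dots> = H \<theta> (\<i> *s v)" using pol[of \<theta> "\<i> *s v"] by (simp add: ii)
    finally have "dir_deriv (\<i> *s \<theta>) (dz_slice v \<phi>) ?x = \<i> * dir_deriv \<theta> (dz_slice v \<phi>) ?x"
      using pol[of \<theta> v] by (simp add: dz_slice_dir_C1(2)[OF \<omega>] H_def field_simps)
    from has_field_derivative_complex_plane[OF S \<omega> dz_slice_dir_C1(1) dz_slice_dir_C1(1) this]
    have "((\<lambda>\<zeta>. dz_slice v \<phi> (?x + Re \<zeta> *\<^sub>R \<theta> + Im \<zeta> *\<^sub>R (\<i> *s \<theta>))) has_field_derivative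
        dir_deriv \<theta> (dz_slice v \<phi>) ?x) (at 0)" .
    moreover have "?x + Re \<zeta> *\<^sub>R \<theta> + Im \<zeta> *\<^sub>R (\<i> *s \<theta>) = z + (\<zeta> + \<omega>) *s \<theta>" for \<zeta>
      by (simp add: vec_eq_iff complex_eq_iff algebra_simps)
    ultimately show ?thesis
      using DERIV_shift[of "\<lambda>\<zeta>. dz_slice v \<phi> (z + \<zeta> *s \<theta>)" _ 0 \<omega>] by auto
  qed
  then show ?thesis
    using open_U by (auto simp: holomorphic_on_open)
qed

lemma dz_slice_smult:
  assumes z: "z \<in> S"
  shows "dz_slice (c *s v) \<phi> z = c * dz_slice v \<phi> z"
proof -
  have D: "dir_deriv (a *\<^sub>R v + b *\<^sub>R (\<i> *s v)) \<phi> z = a *\<^sub>R dir_deriv v \<phi> z + b *\<^sub>R dir_deriv (\<i> *s v) \<phi> z" for a b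
    by (simp add: dir_deriv_additive[OF S z dir_C1 dir_C1] dir_deriv_scaleR[OF dir_C1 z])
  have "c *s v = Re c *\<^sub>R v + Im c *\<^sub>R (\<i> *s v)" "\<i> *s (c *s v) = (- Im c) *\<^sub>R v + Re c *\<^sub>R (\<i> *s v)"
    by (simp_all add: vec_eq_iff complex_eq_iff algebra_simps)
  then show ?thesis
    unfolding dz_slice_def by (simp only: D) (simp add: complex_eq_iff field_simps)
qed

end

section \<open>Pluriharmonic mappings and their real derivative\<close>

lemma slice_harmonic_on_add:
  fixes f g :: "complex^'n \<Rightarrow> complex"
  assumes "slice_harmonic_on S f" "slice_harmonic_on S g"
  shows "slice_harmonic_on S (\<lambda>z. f z + g z)"
  unfolding slice_harmonic_on_def
proof (intro conjI allI impI)
  show "continuous_on S (\<lambda>z. f z + g z)"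
    using assms by (auto simp: slice_harmonic_on_def intro: continuous_on_add)
  fix z v :: "complex^'n" and d :: real assume d: "0 < d" "ball z (d * norm v) \<subseteq> S"
  from slice_harmonic_onD[OF assms(1) d] obtain A B where 1: "A holomorphic_on ball 0 d" "B holomorphic_on ball 0 d"
    "\<And>\<zeta>. \<zeta> \<in> ball 0 d \<Longrightarrow> f (z + \<zeta> *s v) = A \<zeta> + cnj (B \<zeta>)" by blast
  from slice_harmonic_onD[OF assms(2) d] obtain C D where 2: "C holomorphic_on ball 0 d" "D holomorphic_on ball 0 d"
    "\<And>\<zeta>. \<zeta> \<in> ball 0 d \<Longrightarrow> g (z + \<zeta> *s v) = C \<zeta> + cnj (D \<zeta>)" by blast
  show "\<exists>A B. A holomorphic_on ball 0 d \<and> B holomorphic_on ball 0 d \<and>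
      (\<forall>\<zeta>\<in>ball 0 d. f (z + \<zeta> *s v) + g (z + \<zeta> *s v) = A \<zeta> + cnj (B \<zeta>))"
    by (rule exI[of _ "\<lambda>\<zeta>. A \<zeta> + C \<zeta>"], rule exI[of _ "\<lambda>\<zeta>. B \<zeta> + D \<zeta>"])
       (simp add: 1 2 holomorphic_on_add)
qed

lemma slice_harmonic_on_cmult:
  fixes f :: "complex^'n \<Rightarrow> complex"
  assumes "slice_harmonic_on S f"
  shows "slice_harmonic_on S (\<lambda>z. c * f z)"
  unfolding slice_harmonic_on_def
proof (intro conjI allI impI)
  show "continuous_on S (\<lambda>z. c * f z)"
    using assms by (auto simp: slice_harmonic_on_def intro: continuous_on_mult_left)
  fix z v :: "complex^'n" and d :: real assume d: "0 < d" "ball z (d * norm v) \<subseteq> S"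
  from slice_harmonic_onD[OF assms(1) d] obtain A B where 1: "A holomorphic_on ball 0 d" "B holomorphic_on ball 0 d"
    "\<And>\<zeta>. \<zeta> \<in> ball 0 d \<Longrightarrow> f (z + \<zeta> *s v) = A \<zeta> + cnj (B \<zeta>)" by blast
  show "\<exists>A B. A holomorphic_on ball 0 d \<and> B holomorphic_on ball 0 d \<and>
      (\<forall>\<zeta>\<in>ball 0 d. c * f (z + \<zeta> *s v) = A \<zeta> + cnj (B \<zeta>))"
    by (rule exI[of _ "\<lambda>\<zeta>. c * A \<zeta>"], rule exI[of _ "\<lambda>\<zeta>. cnj c * B \<zeta>"])
       (simp add: 1 holomorphic_on_mult distrib_left)
qed

lemma slice_harmonic_on_cnj:
  fixes f :: "complex^'n \<Rightarrow> complex"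
  assumes "slice_harmonic_on S f"
  shows "slice_harmonic_on S (\<lambda>z. cnj (f z))"
  unfolding slice_harmonic_on_def
proof (intro conjI allI impI)
  show "continuous_on S (\<lambda>z. cnj (f z))"
    using assms by (auto simp: slice_harmonic_on_def intro: continuous_on_cnj)
  fix z v :: "complex^'n" and d :: real assume d: "0 < d" "ball z (d * norm v) \<subseteq> S"
  from slice_harmonic_onD[OF assms(1) d] obtain A B where 1: "A holomorphic_on ball 0 d" "B holomorphic_on ball 0 d"
    "\<And>\<zeta>. \<zeta> \<in> ball 0 d \<Longrightarrow> f (z + \<zeta> *s v) = A \<zeta> + cnj (B \<zeta>)" by blast
  show "\<exists>A B. A holomorphic_on ball 0 d \<and> B holomorphic_on ball 0 d \<and>
      (\<forall>\<zeta>\<in>ball 0 d. cnj (f (z + \<zeta> *s v)) = A \<zeta> + cnj (B \<zeta>))"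
    by (rule exI[of _ B], rule exI[of _ A]) (simp add: 1 add.commute)
qed

lemma slice_harmonic_on_sum:
  fixes f :: "'j \<Rightarrow> complex^'n \<Rightarrow> complex"
  assumes "\<And>j. j \<in> J \<Longrightarrow> slice_harmonic_on S (f j)"
  shows "slice_harmonic_on S (\<lambda>z. \<Sum>j\<in>J. f j z)"
  using assms
proof (induction J rule: infinite_finite_induct)
  case (insert j J)
  then show ?case by (simp add: slice_harmonic_on_add)
qed (auto simp: slice_harmonic_on_def intro!: exI[of _ "\<lambda>_. 0"])

lemma slice_harmonic_on_inner:
  fixes f :: "complex^'n \<Rightarrow> complex^'m"
  assumes "\<And>j. slice_harmonic_on S (\<lambda>z. f z $ j)"
  shows "slice_harmonic_on S (\<lambda>z. complex_of_real (f z \<bullet> e))"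
proof -
  have "complex_of_real (f z \<bullet> e) = (\<Sum>j\<in>UNIV. (cnj (e $ j) / 2) * f z $ j + (e $ j / 2) * cnj (f z $ j))" for z
    by (simp add: inner_vec_def inner_complex_def)
       (intro sum.cong refl, simp add: complex_eq_iff field_simps)
  moreover have "slice_harmonic_on S (\<lambda>z. \<Sum>j\<in>UNIV. (cnj (e $ j) / 2) * f z $ j + (e $ j / 2) * cnj (f z $ j))"
    by (intro slice_harmonic_on_sum slice_harmonic_on_add slice_harmonic_on_cmult slice_harmonic_on_cnj assms)
  ultimately show ?thesis by simp
qed

text \<open>Additivity of the derivative in its direction reduces a general direction to coordinate axes.\<close>

lemma dir_deriv_wirtinger:
  fixes \<phi> :: "complex^'n \<Rightarrow> complex"
  assumes S: "open S" and \<phi>: "slice_harmonic_on S \<phi>" and z: "z \<in> S"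
  shows "dir_deriv v \<phi> z = (\<Sum>k\<in>UNIV. wirtinger k \<phi> z * v $ k + wirtinger_bar k \<phi> z * cnj (v $ k))"
proof -
  note C1 = slice_harmonic_on_dir_C1[OF S \<phi>]
  have sum: "dir_deriv (\<Sum>k\<in>A. w k) \<phi> z = (\<Sum>k\<in>A. dir_deriv (w k) \<phi> z)"
    if "finite A" for A and w :: "'n \<Rightarrow> complex^'n"
    using that
  proof induction
    case empty
    then show ?case using dir_deriv_scaleR[OF C1 z, of 0 0] by simp
  qed (simp add: dir_deriv_additive[OF S z C1 C1])
  have axis: "dir_deriv (axis k c) \<phi> z = wirtinger k \<phi> z * c + wirtinger_bar k \<phi> z * cnj c" for k c
  proof -
    have "axis k c = Re c *\<^sub>R axis k 1 + Im c *\<^sub>R axis k \<i>"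
      by (simp add: vec_eq_iff axis_def complex_eq_iff)
    then have "dir_deriv (axis k c) \<phi> z = Re c *\<^sub>R dir_deriv (axis k 1) \<phi> z + Im c *\<^sub>R dir_deriv (axis k \<i>) \<phi> z"
      by (simp only: dir_deriv_additive[OF S z C1 C1] dir_deriv_scaleR[OF C1 z])
    then show ?thesis
      by (simp add: wirtinger_def wirtinger_bar_def complex_eq_iff field_simps)
  qed
  have "v = (\<Sum>k\<in>UNIV. axis k (v $ k))"
    by (simp add: vec_eq_iff axis_def sum.delta)
  then have "dir_deriv v \<phi> z = (\<Sum>k\<in>UNIV. dir_deriv (axis k (v $ k)) \<phi> z)"
    using sum[of UNIV "\<lambda>k. axis k (v $ k)"] by simp
  then show ?thesis by (simp add: axis)
qed

text \<open>The real differential whose extreme stretchings are \<^const>\<open>Lambda_max\<close> and \<^const>\<open>lambda_min\<close>.\<close>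

definition real_deriv :: "(complex^'n \<Rightarrow> complex^'n) \<Rightarrow> complex^'n \<Rightarrow> complex^'n \<Rightarrow> complex^'n" where
  "real_deriv f z \<theta> = jac_z f z *v \<theta> + jac_zbar f z *v vec_cnj \<theta>"

lemma dir_deriv_inner:
  fixes f :: "complex^'n \<Rightarrow> complex^'n"
  assumes S: "open S" and f: "\<And>j. slice_harmonic_on S (\<lambda>z. f z $ j)" and z: "z \<in> S"
  shows "dir_deriv v (\<lambda>z. complex_of_real (f z \<bullet> e)) z = of_real (real_deriv f z v \<bullet> e)"
proof (rule dir_deriv_eqI)
  have comp: "real_deriv f z v $ j = dir_deriv v (\<lambda>z. f z $ j) z" for j
    by (simp add: real_deriv_def matrix_vector_mult_def jac_z_def jac_zbar_def vec_cnj_def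
        dir_deriv_wirtinger[OF S f z] sum.distrib)
  have "((\<lambda>t. \<Sum>j\<in>UNIV. complex_of_real (f (z + t *\<^sub>R v) $ j \<bullet> e $ j)) has_vector_derivative
      (\<Sum>j\<in>UNIV. complex_of_real (dir_deriv v (\<lambda>z. f z $ j) z \<bullet> e $ j))) (at 0)"
  proof (rule has_vector_derivative_sum)
    fix j
    have bl: "bounded_linear (\<lambda>x. complex_of_real (x \<bullet> e $ j))"
      by (intro bounded_linear_compose[OF bounded_linear_of_real] bounded_linear_inner_left)
    show "((\<lambda>t. complex_of_real (f (z + t *\<^sub>R v) $ j \<bullet> e $ j)) has_vector_derivative
        complex_of_real (dir_deriv v (\<lambda>z. f z $ j) z \<bullet> e $ j)) (at 0)"
      using slice_harmonic_on_dir_C1[OF S f, of v j] z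
      by (intro bounded_linear.has_vector_derivative[OF bl] dir_deriv_works) (simp add: dir_C1_on_def)
  qed
  then show "((\<lambda>t. complex_of_real (f (z + t *\<^sub>R v) \<bullet> e)) has_vector_derivative
      of_real (real_deriv f z v \<bullet> e)) (at 0)"
    by (simp add: inner_vec_def comp)
qed

lemma linear_real_deriv: "linear (real_deriv f z)"
  unfolding real_deriv_def
proof (rule linearI)
  show "jac_z f z *v (x + y) + jac_zbar f z *v vec_cnj (x + y) =
      (jac_z f z *v x + jac_zbar f z *v vec_cnj x) + (jac_z f z *v y + jac_zbar f z *v vec_cnj y)" for x y
    by (simp add: vec_eq_iff matrix_vector_mult_def vec_cnj_def algebra_simps sum.distrib)
  show "jac_z f z *v (c *\<^sub>R x) + jac_zbar f z *v vec_cnj (c *\<^sub>R x) =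
      c *\<^sub>R (jac_z f z *v x + jac_zbar f z *v vec_cnj x)" for c x
    by (simp add: vec_eq_iff matrix_vector_mult_def vec_cnj_def scaleR_conv_of_real[where 'a=complex]
        algebra_simps sum_distrib_left)
qed

text \<open>Twice the \<open>\<partial>\<close>-part is complex linear in the direction, so rotating the direction by a unimodular factor makes its value real;
it is then a component of the real differential, and no larger than the norm of the differential.\<close>

lemma norm_dz_slice_inner_le:
  fixes f :: "complex^'n \<Rightarrow> complex^'n"
  assumes S: "open S" and f: "\<And>j. slice_harmonic_on S (\<lambda>z. f z $ j)" and z: "z \<in> S"
    and M: "\<And>\<theta>. norm \<theta> = 1 \<Longrightarrow> norm (real_deriv f z \<theta>) \<le> M"
    and e: "norm e = 1" and v: "norm v = 1"
  shows "cmod (2 * dz_slice v (\<lambda>z. complex_of_real (f z \<bullet> e)) z) \<le> M"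
    and "Re (2 * dz_slice v (\<lambda>z. complex_of_real (f z \<bullet> e)) z) = real_deriv f z v \<bullet> e"
proof -
  let ?\<psi> = "\<lambda>z. complex_of_real (f z \<bullet> e)"
  have Re: "Re (2 * dz_slice v ?\<psi> z) = real_deriv f z v \<bullet> e" for v
    by (simp add: dz_slice_def dir_deriv_inner[OF S f z])
  then show "Re (2 * dz_slice v ?\<psi> z) = real_deriv f z v \<bullet> e" .
  let ?c = "2 * dz_slice v ?\<psi> z"
  show "cmod ?c \<le> M"
  proof (cases "?c = 0")
    case True
    have "0 \<le> M" using M[OF v] norm_ge_zero order_trans by blast
    then show ?thesis using True by simp
  next
    case False
    define w where "w = cnj (sgn ?c)"
    have w: "cmod w = 1" using False by (simp add: w_def norm_sgn)
    have "2 * dz_slice (w *s v) ?\<psi> z = w * ?c"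
      by (simp add: dz_slice_smult[OF S slice_harmonic_on_inner[OF f] z])
    also have "\<dots> = of_real (cmod ?c)"
    proof -
      have "w * ?c = ?c * cnj ?c / of_real (cmod ?c)"
        by (simp only: w_def sgn_eq complex_cnj_divide complex_cnj_complex_of_real) simp
      also have "\<dots> = of_real (cmod ?c)"
        using False by (simp only: complex_norm_square[symmetric]) (simp add: power2_eq_square)
      finally show ?thesis .
    qed
    finally have "cmod ?c = real_deriv f z (w *s v) \<bullet> e"
      using Re[of "w *s v"] by simp
    also have "\<dots> \<le> norm (real_deriv f z (w *s v)) * norm e" by (rule norm_cauchy_schwarz)
    also have "\<dots> \<le> M" using M[of "w *s v"] w v e by (simp add: norm_vector_smult_complex)
    finally show ?thesis .
  qed
qed

section \<open>A Schwarz--Pick estimate for off-centre points\<close>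

text \<open>A form of the Schwarz--Pick lemma that bounds the increment \<open>h w - h 0\<close> without any reference to its direction. It
follows from the usual form by the identity
\<open>|1 - cnj b y|\<^sup>2 = |y - b|\<^sup>2 + (1 - |b|\<^sup>2) (1 - |y|\<^sup>2)\<close>.\<close>

lemma Schwarz_Pick_increment_strict:
  assumes h: "h holomorphic_on ball 0 1" and lt: "\<And>w. w \<in> ball 0 1 \<Longrightarrow> cmod (h w) < 1"
    and w: "w \<in> ball 0 1"
  shows "(1 - (cmod w)\<^sup>2) * (cmod (h w - h 0))\<^sup>2 \<le> (cmod w)\<^sup>2 * (1 - (cmod (h 0))\<^sup>2)"
proof -
  define b where "b = h 0"
  have b: "cmod b < 1" using lt[of 0] by (simp add: b_def)
  define k where "k = Moebius_function 0 b \<circ> h"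
  have "k holomorphic_on ball 0 1"
    unfolding k_def using lt b
    by (intro holomorphic_on_compose_gen[OF h Moebius_function_holomorphic]) auto
  moreover have "k 0 = 0" by (simp add: k_def b_def Moebius_function_eq_zero)
  moreover have "cmod (k z) < 1" if "cmod z < 1" for z
    using lt[of z] b that by (simp add: k_def Moebius_function_norm_lt_1)
  ultimately have "cmod (k w) \<le> cmod w"
    using w by (intro Schwarz_Lemma(1)) auto
  moreover have "1 - cnj b * h w \<noteq> 0"
  proof
    assume "1 - cnj b * h w = 0"
    then have "cmod (cnj b * h w) = 1" by simp
    moreover have "cmod b * cmod (h w) < 1"
      using b lt[OF w] mult_strict_mono[of "cmod b" 1 "cmod (h w)" 1] by simp
    ultimately show False by (simp add: norm_mult)
  qed
  ultimately have "cmod (h w - b) \<le> cmod w * cmod (1 - cnj b * h w)"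
    by (simp add: k_def Moebius_function_simple norm_divide divide_le_eq)
  then have 1: "(cmod (h w - b))\<^sup>2 \<le> (cmod w)\<^sup>2 * (cmod (1 - cnj b * h w))\<^sup>2"
    using power_mono[of "cmod (h w - b)" "cmod w * cmod (1 - cnj b * h w)" 2] by (simp add: power_mult_distrib)
  have "(cmod (1 - cnj b * h w))\<^sup>2 = (cmod (h w - b))\<^sup>2 + (1 - (cmod b)\<^sup>2) * (1 - (cmod (h w))\<^sup>2)"
    by (simp only: cmod_power2) (simp add: power2_eq_square algebra_simps)
  also have "\<dots> \<le> (cmod (h w - b))\<^sup>2 + (1 - (cmod b)\<^sup>2) * 1"
    using b by (intro add_left_mono mult_left_mono) (auto simp: power2_eq_square mult_le_one)
  finally have "(cmod w)\<^sup>2 * (cmod (1 - cnj b * h w))\<^sup>2 \<le> (cmod w)\<^sup>2 * ((cmod (h w - b))\<^sup>2 + (1 - (cmod b)\<^sup>2))"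
    by (intro mult_left_mono) auto
  with 1 show ?thesis
    by (simp add: b_def[symmetric] algebra_simps)
qed

lemma Schwarz_Pick_increment:
  assumes h: "h holomorphic_on ball 0 1" and le: "\<And>w. w \<in> ball 0 1 \<Longrightarrow> cmod (h w) \<le> 1"
    and w: "w \<in> ball 0 1"
  shows "(1 - (cmod w)\<^sup>2) * (cmod (h w - h 0))\<^sup>2 \<le> (cmod w)\<^sup>2 * (1 - (cmod (h 0))\<^sup>2)"
proof -
  have "(1 - (cmod w)\<^sup>2) * (cmod (h w - h 0))\<^sup>2 + (cmod w)\<^sup>2 * (cmod (h 0))\<^sup>2 \<le> (cmod w)\<^sup>2"
  \<comment> \<open>Functions that touch the unit circle are approximated by their multiples with a factor \<open>s < 1\<close>; here \<open>y = s\<^sup>2\<close>.\<close>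
  proof (rule field_le_mult_one_interval)
    fix y :: real assume y: "0 < y" "y < 1"
    define s where "s = sqrt y"
    have s: "0 < s" "s < 1" "y = s\<^sup>2" using y by (auto simp: s_def)
    have "(\<lambda>z. of_real s * h z) holomorphic_on ball 0 1" by (intro holomorphic_intros h)
    moreover have "cmod (of_real s * h z) < 1" if "z \<in> ball 0 1" for z
    proof -
      have "cmod (of_real s * h z) = s * cmod (h z)" using s by (simp add: norm_mult)
      also have "\<dots> \<le> s * 1" using s le[OF that] by (intro mult_left_mono) auto
      finally show ?thesis using s by linarith
    qed
    ultimately have "(1 - (cmod w)\<^sup>2) * (cmod (of_real s * h w - of_real s * h 0))\<^sup>2
        \<le> (cmod w)\<^sup>2 * (1 - (cmod (of_real s * h 0))\<^sup>2)"
      using w by (rule Schwarz_Pick_increment_strict)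
    moreover have "of_real s * h w - of_real s * h 0 = of_real s * (h w - h 0)"
      by (simp add: right_diff_distrib)
    ultimately show "y * ((1 - (cmod w)\<^sup>2) * (cmod (h w - h 0))\<^sup>2 + (cmod w)\<^sup>2 * (cmod (h 0))\<^sup>2) \<le> (cmod w)\<^sup>2"
      using s by (simp add: norm_mult power_mult_distrib) (simp add: algebra_simps)
  qed
  then show ?thesis by (simp add: algebra_simps)
qed

text \<open>The disc has centre \<open>-c\<close>, so that the base point \<open>0\<close> is off centre; \<open>X\<close> is the pseudohyperbolic distance of
\<open>\<zeta>\<close> from \<open>0\<close> in this disc.\<close>

lemma Schwarz_Pick_increment_disc:
  assumes g: "g holomorphic_on {\<zeta>. cmod (\<zeta> + c) < T}" and le: "\<And>\<zeta>. cmod (\<zeta> + c) < T \<Longrightarrow> cmod (g \<zeta>) \<le> M"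
    and c: "cmod c < T" and M: "0 < M" and \<zeta>: "cmod (\<zeta> + c) < T"
  defines "X \<equiv> T * cmod \<zeta> / cmod (of_real (T\<^sup>2 - (cmod c)\<^sup>2) - cnj c * \<zeta>)"
  shows "(1 - X\<^sup>2) * (cmod (g \<zeta> - g 0))\<^sup>2 \<le> X\<^sup>2 * (M\<^sup>2 - (cmod (g 0))\<^sup>2)"
proof -
  have T: "T > 0" using c norm_ge_zero[of c] by linarith
  define b where "b = c / of_real T"
  have b: "cmod b < 1" using c T by (simp add: b_def norm_divide)
  let ?m = "Moebius_function 0 (- b)"
  define h where "h = (\<lambda>\<eta>. g (of_real T * ?m \<eta> - c) / of_real M)"
  have m: "cmod (?m \<eta>) < 1" if "cmod \<eta> < 1" for \<eta>
    using b that by (simp add: Moebius_function_norm_lt_1)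
  have in_disc: "cmod (of_real T * ?m \<eta> - c + c) < T" if "cmod \<eta> < 1" for \<eta>
    using m[OF that] T by (simp add: norm_mult)
  have "(g \<circ> (\<lambda>\<eta>. of_real T * ?m \<eta> - c)) holomorphic_on ball 0 1"
    using b in_disc
    by (intro holomorphic_on_compose_gen[OF _ g] holomorphic_intros Moebius_function_holomorphic) auto
  then have h: "h holomorphic_on ball 0 1"
    using M unfolding h_def o_def by - (rule holomorphic_on_divide[OF _ holomorphic_on_const], auto)
  have hle: "cmod (h \<eta>) \<le> 1" if "\<eta> \<in> ball 0 1" for \<eta>
    using le[OF in_disc, of \<eta>] that M by (simp add: h_def norm_divide)
  define \<eta> where "\<eta> = Moebius_function 0 b ((\<zeta> + c) / of_real T)"
  have z1: "cmod ((\<zeta> + c) / of_real T) < 1" using \<zeta> T by (simp add: norm_divide)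
  then have \<eta>: "\<eta> \<in> ball 0 1" using b by (simp add: \<eta>_def Moebius_function_norm_lt_1)
  have "?m \<eta> = (\<zeta> + c) / of_real T"
    unfolding \<eta>_def using b z1 by (intro Moebius_function_compose) auto
  then have h\<eta>: "h \<eta> = g \<zeta> / of_real M" using T by (simp add: h_def)
  have "?m 0 = b" using Moebius_function_of_zero[of 0 "- b"] by simp
  then have h0: "h 0 = g 0 / of_real M" using T by (simp add: h_def b_def)
  have "cmod \<eta> = X"
  proof -
    have "\<eta> = (of_real T * \<zeta>) / (of_real (T\<^sup>2) - cnj c * (\<zeta> + c))"
    proof -
      have "\<eta> = (\<zeta> / of_real T) / (1 - cnj c * (\<zeta> + c) / of_real (T\<^sup>2))"
        by (simp add: \<eta>_def Moebius_function_simple b_def power2_eq_square flip: diff_divide_distrib)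
      also have "\<dots> = (of_real (T\<^sup>2) * (\<zeta> / of_real T)) / (of_real (T\<^sup>2) * (1 - cnj c * (\<zeta> + c) / of_real (T\<^sup>2)))"
        using T by (subst mult_divide_mult_cancel_left) auto
      also have "of_real (T\<^sup>2) * (\<zeta> / of_real T) = of_real T * \<zeta>"
        using T by (simp add: power2_eq_square)
      also have "of_real (T\<^sup>2) * (1 - cnj c * (\<zeta> + c) / of_real (T\<^sup>2)) = of_real (T\<^sup>2) - cnj c * (\<zeta> + c)"
        using T by (simp add: right_diff_distrib)
      finally show ?thesis .
    qed
    also have "of_real (T\<^sup>2) - cnj c * (\<zeta> + c) = of_real (T\<^sup>2 - (cmod c)\<^sup>2) - cnj c * \<zeta>"
      by (simp add: algebra_simps complex_norm_square del: of_real_power)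
    finally show ?thesis using T by (simp add: X_def norm_divide norm_mult)
  qed
  then have "(1 - X\<^sup>2) * (cmod ((g \<zeta> - g 0) / of_real M))\<^sup>2 \<le> X\<^sup>2 * (1 - (cmod (g 0 / of_real M))\<^sup>2)"
    using Schwarz_Pick_increment[OF h hle \<eta>] by (simp add: h\<eta> h0 diff_divide_distrib)
  then have "M\<^sup>2 * ((1 - X\<^sup>2) * (cmod ((g \<zeta> - g 0) / of_real M))\<^sup>2) \<le> M\<^sup>2 * (X\<^sup>2 * (1 - (cmod (g 0 / of_real M))\<^sup>2))"
    by (rule mult_left_mono) simp
  then show ?thesis
    using M by (simp add: norm_divide power_divide right_diff_distrib mult_ac)
qed

text \<open>The pseudohyperbolic distance from the base point is at most \<open>x = R t / (D - p t)\<close>, and the increment of \<open>g\<close> is then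
bounded by \<open>x sqrt (M\<^sup>2 - a\<^sup>2) / sqrt (1 - x\<^sup>2)\<close>. As a function of \<open>t\<close> this bound divided by \<open>t\<close> is increasing, and the bound equals \<open>a\<close> at
\<open>t = a D / (M R + a p)\<close>, which is where \<open>x = a / M\<close>; so up to this point it lies below a linear function of \<open>t\<close>.\<close>

lemma Re_lower_bound_disc:
  assumes g: "g holomorphic_on {\<zeta>. cmod (\<zeta> + c) < T}" and le: "\<And>\<zeta>. cmod (\<zeta> + c) < T \<Longrightarrow> cmod (g \<zeta>) \<le> M"
    and a: "0 < a" "a \<le> Re (g 0)"
    and D: "0 < D" "D \<le> T\<^sup>2 - (cmod c)\<^sup>2" and R: "0 < T" "T \<le> R" and p: "cmod c \<le> p"
    and t: "cmod \<zeta> < a * D / (M * R + a * p)"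
  shows "cmod (\<zeta> + c) < T"
    and "Re (g \<zeta>) \<ge> a - cmod \<zeta> * (M * R + a * p) / D"
proof -
  define t where "t = cmod \<zeta>"
  have "(cmod c)\<^sup>2 < T\<^sup>2" using D by linarith
  then have c: "cmod c < T" using R by (simp add: power2_less_imp_less)
  have aM: "a \<le> M"
    using a le[of 0] c complex_Re_le_cmod[of "g 0"] by simp
  then have M: "M > 0" using a by simp
  have p0: "0 \<le> p" using p norm_ge_zero order_trans by blast
  have pos: "0 < M * R + a * p" using M R a p0 by (intro add_pos_nonneg) auto
  have tD: "t * (M * R + a * p) < a * D"
    using t pos by (simp add: t_def pos_less_divide_eq)
  have t0: "0 \<le> t" by (simp add: t_def)
  have "t * (a * (T + cmod c)) \<le> t * (M * R + a * p)"
  proof -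
    have "a * T \<le> M * R" using aM R a by (intro mult_mono) auto
    moreover have "a * cmod c \<le> a * p" using p a by (intro mult_left_mono) auto
    ultimately show ?thesis using t0 by (intro mult_left_mono) (auto simp: distrib_left)
  qed
  also note tD
  also have "a * D \<le> a * (T\<^sup>2 - (cmod c)\<^sup>2)" using D a by (intro mult_left_mono) auto
  finally have "a * (t * (T + cmod c)) < a * ((T - cmod c) * (T + cmod c))"
    by (simp add: algebra_simps power2_eq_square)
  then have "t < T - cmod c"
    using a R c by (simp add: mult_less_cancel_left_pos mult_less_cancel_right_pos add_pos_nonneg)
  then show in_disc: "cmod (\<zeta> + c) < T"
    using norm_triangle_ineq[of \<zeta> c] by (simp add: t_def)
  define X where "X = T * cmod \<zeta> / cmod (of_real (T\<^sup>2 - (cmod c)\<^sup>2) - cnj c * \<zeta>)"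
  have SP: "(1 - X\<^sup>2) * (cmod (g \<zeta> - g 0))\<^sup>2 \<le> X\<^sup>2 * (M\<^sup>2 - (cmod (g 0))\<^sup>2)"
    unfolding X_def using Schwarz_Pick_increment_disc[OF g le c M in_disc] by blast
  have Dpt: "M * (R * t) < a * (D - p * t)" using tD by (simp add: algebra_simps)
  moreover have "0 \<le> M * (R * t)" using M R t0 by simp
  ultimately have "0 < a * (D - p * t)" by linarith
  then have Dpt0: "0 < D - p * t" using a by (simp add: zero_less_mult_iff)
  define x where "x = R * t / (D - p * t)"
  have x: "0 \<le> x" "M * x < a"
    using Dpt0 Dpt R t0 by (auto simp: x_def divide_simps mult_ac)
  have Xx: "X \<le> x"
  proof -
    have "D - p * t \<le> (T\<^sup>2 - (cmod c)\<^sup>2) - cmod c * t"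
      using D mult_right_mono[OF p t0] by linarith
    also have "\<dots> \<le> cmod (of_real (T\<^sup>2 - (cmod c)\<^sup>2)) - cmod (cnj c * \<zeta>)"
      using D by (simp add: t_def norm_mult del: of_real_diff)
    also have "\<dots> \<le> cmod (of_real (T\<^sup>2 - (cmod c)\<^sup>2) - cnj c * \<zeta>)"
      by (rule norm_triangle_ineq2)
    finally show ?thesis
      unfolding X_def x_def t_def[symmetric]
      using Dpt0 R t0 by (intro frac_le mult_right_mono mult_nonneg_nonneg) auto
  qed
  have X0: "0 \<le> X" using R by (simp add: X_def)
  have X2: "X\<^sup>2 \<le> x\<^sup>2" using Xx X0 by (rule power_mono)
  have g0: "a\<^sup>2 \<le> (cmod (g 0))\<^sup>2"
    using a complex_Re_le_cmod[of "g 0"] by (intro power_mono) auto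
  have aM2: "a\<^sup>2 \<le> M\<^sup>2" using aM a by (intro power_mono) auto
  have "(1 - x\<^sup>2) * (cmod (g \<zeta> - g 0))\<^sup>2 \<le> (1 - X\<^sup>2) * (cmod (g \<zeta> - g 0))\<^sup>2"
    using X2 by (intro mult_right_mono) auto
  also note SP
  also have "X\<^sup>2 * (M\<^sup>2 - (cmod (g 0))\<^sup>2) \<le> X\<^sup>2 * (M\<^sup>2 - a\<^sup>2)"
    using g0 by (intro mult_left_mono) auto
  also have "\<dots> \<le> x\<^sup>2 * (M\<^sup>2 - a\<^sup>2)"
    using X2 aM2 by (intro mult_right_mono) auto
  finally have SPx: "(1 - x\<^sup>2) * (cmod (g \<zeta> - g 0))\<^sup>2 \<le> x\<^sup>2 * (M\<^sup>2 - a\<^sup>2)" .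
  define y where "y = t * (M * R + a * p) / D"
  have y0: "0 \<le> y" using t0 pos D by (simp add: y_def)
  have Rpx: "0 < R + p * x" using R p0 x by (intro add_pos_nonneg) auto
  have "t * (R + p * x) = x * D"
    using Dpt0 by (simp add: x_def field_simps)
  then have yx: "y * (R + p * x) = x * (M * R + a * p)"
    using D by (simp add: y_def field_simps)
  have x1: "x\<^sup>2 < 1"
  proof -
    have "M * x < M * 1" using x aM by linarith
    then have "x < 1" using M by (simp add: mult_less_cancel_left_pos)
    then show ?thesis using x by (simp add: abs_square_less_1)
  qed
  \<comment> \<open>Equality holds at \<open>x = a / M\<close>, and the left side increases in \<open>x\<close> while the right side decreases.\<close>
  have key: "(M\<^sup>2 - a\<^sup>2) * (R + p * x)\<^sup>2 \<le> (1 - x\<^sup>2) * (M * R + a * p)\<^sup>2"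
  proof -
    have "M * (R + p * x) \<le> M * R + a * p"
      using mult_right_mono[of "M * x" a p] x p0 by (simp add: algebra_simps)
    then have "(M * (R + p * x))\<^sup>2 \<le> (M * R + a * p)\<^sup>2"
      using M Rpx by (intro power_mono) auto
    moreover have "M\<^sup>2 - a\<^sup>2 \<le> M\<^sup>2 * (1 - x\<^sup>2)"
    proof -
      have "(M * x)\<^sup>2 \<le> a\<^sup>2" using x M by (intro power_mono) auto
      then show ?thesis by (simp add: algebra_simps power_mult_distrib)
    qed
    then have "(M\<^sup>2 - a\<^sup>2) * (R + p * x)\<^sup>2 \<le> M\<^sup>2 * (1 - x\<^sup>2) * (R + p * x)\<^sup>2"
      by (rule mult_right_mono) simp
    moreover have "M\<^sup>2 * (1 - x\<^sup>2) * (R + p * x)\<^sup>2 = (1 - x\<^sup>2) * (M * (R + p * x))\<^sup>2"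
      by (simp add: power_mult_distrib)
    ultimately show ?thesis
      using mult_left_mono[of "(M * (R + p * x))\<^sup>2" "(M * R + a * p)\<^sup>2" "1 - x\<^sup>2"] x1 by linarith
  qed
  have "(1 - x\<^sup>2) * (cmod (g \<zeta> - g 0) * (R + p * x))\<^sup>2 \<le> (x\<^sup>2 * (M\<^sup>2 - a\<^sup>2)) * (R + p * x)\<^sup>2"
    using mult_right_mono[OF SPx, of "(R + p * x)\<^sup>2"] by (simp add: power_mult_distrib mult.assoc)
  also have "\<dots> \<le> x\<^sup>2 * ((1 - x\<^sup>2) * (M * R + a * p)\<^sup>2)"
    using mult_left_mono[OF key, of "x\<^sup>2"] by (simp add: mult.assoc)
  also have "\<dots> = (1 - x\<^sup>2) * (y * (R + p * x))\<^sup>2"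
    by (simp add: yx power_mult_distrib)
  finally have "(cmod (g \<zeta> - g 0) * (R + p * x))\<^sup>2 \<le> (y * (R + p * x))\<^sup>2"
    using x1 by (simp only: mult_le_cancel_left_pos diff_gt_0_iff_gt)
  then have "cmod (g \<zeta> - g 0) * (R + p * x) \<le> y * (R + p * x)"
    by (rule power2_le_imp_le) (use y0 Rpx in simp)
  then have "cmod (g \<zeta> - g 0) \<le> y" using Rpx by (simp only: mult_le_cancel_right_pos)
  moreover have "Re (g 0 - g \<zeta>) \<le> cmod (g \<zeta> - g 0)"
    by (metis complex_Re_le_cmod norm_minus_commute)
  ultimately show "Re (g \<zeta>) \<ge> a - cmod \<zeta> * (M * R + a * p) / D"
    using a by (simp add: y_def t_def)
qed

section \<open>A Landau theorem with the base point off centre\<close>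

lemma has_real_derivative_inner_line:
  fixes f :: "complex^'n \<Rightarrow> complex^'n"
  assumes S: "open S" and f: "\<And>j. slice_harmonic_on S (\<lambda>z. f z $ j)" and z: "x + s *\<^sub>R v \<in> S"
  shows "((\<lambda>t. f (x + t *\<^sub>R v) \<bullet> e) has_real_derivative real_deriv f (x + s *\<^sub>R v) v \<bullet> e) (at s)"
proof -
  have "((\<lambda>t. complex_of_real (f (x + t *\<^sub>R v) \<bullet> e)) has_vector_derivative
      dir_deriv v (\<lambda>z. complex_of_real (f z \<bullet> e)) (x + s *\<^sub>R v)) (at s)"
    by (rule dir_deriv_along_line[OF slice_harmonic_on_dir_C1[OF S slice_harmonic_on_inner[OF f]] z])
  from bounded_linear.has_vector_derivative[OF bounded_linear_Re this]
  show ?thesis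
    by (simp add: dir_deriv_inner[OF S f z] has_real_derivative_iff_has_vector_derivative)
qed

text \<open>The complex line through \<open>z\<close> in the direction \<open>\<theta>\<close> meets balls about the origin in discs with centre \<open>-c\<close>.\<close>

lemma norm_add_smult_sq:
  fixes z \<theta> :: "complex^'n"
  assumes "norm \<theta> = 1"
  defines "c \<equiv> \<Sum>k\<in>UNIV. z $ k * cnj (\<theta> $ k)"
  shows "(norm (z + \<zeta> *s \<theta>))\<^sup>2 = (cmod (\<zeta> + c))\<^sup>2 + ((norm z)\<^sup>2 - (cmod c)\<^sup>2)"
    and "cmod c \<le> norm z"
proof -
  have sq: "(norm x)\<^sup>2 = (\<Sum>k\<in>UNIV. (cmod (x $ k))\<^sup>2)" for x :: "complex^'n"
    by (simp add: norm_vec_def L2_set_def sum_nonneg)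
  have gen: "(norm (z + \<zeta> *s \<theta>))\<^sup>2 = (cmod (\<zeta> + c))\<^sup>2 + ((norm z)\<^sup>2 - (cmod c)\<^sup>2)" for \<zeta>
  proof -
    have "(norm (z + \<zeta> *s \<theta>))\<^sup>2 = (\<Sum>k\<in>UNIV. (cmod (z $ k))\<^sup>2 + 2 * Re (cnj \<zeta> * (z $ k * cnj (\<theta> $ k))) + (cmod \<zeta>)\<^sup>2 * (cmod (\<theta> $ k))\<^sup>2)"
      unfolding sq
      by (intro sum.cong refl) (simp add: cmod_power2, simp add: power2_eq_square algebra_simps)
    also have "\<dots> = (norm z)\<^sup>2 + 2 * Re (cnj \<zeta> * c) + (cmod \<zeta>)\<^sup>2 * (norm \<theta>)\<^sup>2"
      by (simp only: sum.distrib sq c_def sum_distrib_left Re_sum)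
    also have "\<dots> = (norm z)\<^sup>2 + 2 * Re (cnj \<zeta> * c) + (cmod \<zeta>)\<^sup>2"
      using assms(1) by simp
    also have "\<dots> = (cmod (\<zeta> + c))\<^sup>2 + ((norm z)\<^sup>2 - (cmod c)\<^sup>2)"
      by (simp add: cmod_power2, simp add: power2_eq_square algebra_simps)
    finally show ?thesis .
  qed
  then show "(norm (z + \<zeta> *s \<theta>))\<^sup>2 = (cmod (\<zeta> + c))\<^sup>2 + ((norm z)\<^sup>2 - (cmod c)\<^sup>2)" .
  have "0 \<le> (norm (z + (- c) *s \<theta>))\<^sup>2" by simp
  then have "(cmod c)\<^sup>2 \<le> (norm z)\<^sup>2" unfolding gen by simp
  then show "cmod c \<le> norm z" by (rule power2_le_imp_le) simp
qed

text \<open>The derivative in the direction \<open>v\<close> is compared at \<open>z0\<close> and at \<open>z\<close> along the complex line through these two points, whose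
direction is in general different from \<open>v\<close>. The disc that this line cuts out of the ball of radius \<open>R\<close> has radius \<open>T \<le> R\<close>.\<close>

lemma real_deriv_inner_lower_bound:
  fixes f :: "complex^'n \<Rightarrow> complex^'n"
  assumes S: "open S" and f: "\<And>j. slice_harmonic_on S (\<lambda>z. f z $ j)" and R: "ball 0 R \<subseteq> S"
    and M: "\<And>z \<theta>. z \<in> ball 0 R \<Longrightarrow> norm \<theta> = 1 \<Longrightarrow> norm (real_deriv f z \<theta>) \<le> M"
    and p: "norm z0 \<le> p" "p < R" and a: "0 < a" "a \<le> real_deriv f z0 v \<bullet> e"
    and v: "norm v = 1" and e: "norm e = 1"
    and z: "norm (z - z0) < a * (R\<^sup>2 - p\<^sup>2) / (M * R + a * p)"
  shows "z \<in> ball 0 R"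
    and "real_deriv f z v \<bullet> e \<ge> a - norm (z - z0) * (M * R + a * p) / (R\<^sup>2 - p\<^sup>2)"
proof -
  define t where "t = norm (z - z0)"
  obtain \<theta> where \<theta>: "norm \<theta> = 1" "z = z0 + of_real t *s \<theta>"
  proof (cases "z = z0")
    case True
    then show thesis using that[of v] v by (simp add: t_def)
  next
    case False
    then show thesis
      using that[of "(1 / t) *\<^sub>R (z - z0)"] by (simp add: t_def vector_smult_of_real)
  qed
  define c where "c = (\<Sum>k\<in>UNIV. z0 $ k * cnj (\<theta> $ k))"
  note nrm = norm_add_smult_sq[OF \<theta>(1), of z0, folded c_def]
  have R0: "0 < R" using p norm_ge_zero[of z0] by linarith
  have p0: "0 \<le> p" using p norm_ge_zero[of z0] by linarith
  have zp: "(norm z0)\<^sup>2 \<le> p\<^sup>2" using p by (intro power_mono) auto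
  have pR: "p\<^sup>2 < R\<^sup>2" using p p0 by (intro power_strict_mono) auto
  define T where "T = sqrt (R\<^sup>2 - (norm z0)\<^sup>2 + (cmod c)\<^sup>2)"
  have T2: "T\<^sup>2 = R\<^sup>2 - (norm z0)\<^sup>2 + (cmod c)\<^sup>2" using zp pR by (simp add: T_def)
  have T0: "0 < T" using zp pR by (simp add: T_def add_pos_nonneg)
  have c2: "(cmod c)\<^sup>2 \<le> (norm z0)\<^sup>2" using nrm(2) by (intro power_mono) auto
  have TR: "T \<le> R" using c2 T2 R0 by (intro power2_le_imp_le[of T R]) auto
  have disc: "cmod (\<zeta> + c) < T \<longleftrightarrow> z0 + \<zeta> *s \<theta> \<in> ball 0 R" for \<zeta>
  proof -
    have "cmod (\<zeta> + c) < T \<longleftrightarrow> (cmod (\<zeta> + c))\<^sup>2 < T\<^sup>2"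
      unfolding linorder_not_le[symmetric] using less_imp_le[OF T0] by (subst power_mono_iff) auto
    also have "\<dots> \<longleftrightarrow> (norm (z0 + \<zeta> *s \<theta>))\<^sup>2 < R\<^sup>2" unfolding nrm(1) T2 by auto
    also have "\<dots> \<longleftrightarrow> z0 + \<zeta> *s \<theta> \<in> ball 0 R" unfolding mem_ball_0 linorder_not_le[symmetric] using less_imp_le[OF R0] by (subst power_mono_iff) auto
    finally show ?thesis .
  qed
  let ?\<psi> = "\<lambda>z. complex_of_real (f z \<bullet> e)"
  define g where "g = (\<lambda>\<zeta>. 2 * dz_slice v ?\<psi> (z0 + \<zeta> *s \<theta>))"
  have "(\<lambda>\<zeta>. dz_slice v ?\<psi> (z0 + \<zeta> *s \<theta>)) holomorphic_on {\<zeta>. z0 + \<zeta> *s \<theta> \<in> S}"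
    by (rule dz_slice_holomorphic[OF S slice_harmonic_on_inner[OF f]])
  then have "(\<lambda>\<zeta>. dz_slice v ?\<psi> (z0 + \<zeta> *s \<theta>)) holomorphic_on {\<zeta>. cmod (\<zeta> + c) < T}"
    by (rule holomorphic_on_subset) (use disc R in auto)
  then have g: "g holomorphic_on {\<zeta>. cmod (\<zeta> + c) < T}"
    unfolding g_def by (rule holomorphic_on_mult[OF holomorphic_on_const])
  have gM: "cmod (g \<zeta>) \<le> M" and gRe: "Re (g \<zeta>) = real_deriv f (z0 + \<zeta> *s \<theta>) v \<bullet> e"
    if "cmod (\<zeta> + c) < T" for \<zeta>
  proof -
    have in_ball: "z0 + \<zeta> *s \<theta> \<in> ball 0 R" using that disc by blast
    note bounds = norm_dz_slice_inner_le[OF S f subsetD[OF R in_ball] M[OF in_ball] e v]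
    show "cmod (g \<zeta>) \<le> M" unfolding g_def by (rule bounds(1))
    show "Re (g \<zeta>) = real_deriv f (z0 + \<zeta> *s \<theta>) v \<bullet> e" unfolding g_def by (rule bounds(2))
  qed
  have c0: "cmod (0 + c) < T" using T2 zp pR T0 by (simp add: power2_less_imp_less)
  have "z0 + 0 *s \<theta> = z0" by (simp add: vec_eq_iff)
  then have g0: "a \<le> Re (g 0)" using gRe[OF c0] a by simp
  have t: "cmod (of_real t) = t" by (simp add: t_def)
  have D: "0 < R\<^sup>2 - p\<^sup>2" "R\<^sup>2 - p\<^sup>2 \<le> T\<^sup>2 - (cmod c)\<^sup>2" using pR zp T2 by auto
  have small: "cmod (of_real t) < a * (R\<^sup>2 - p\<^sup>2) / (M * R + a * p)" using z unfolding t t_def[symmetric] .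
  have cp: "cmod c \<le> p" using nrm(2) p(1) by linarith
  have bd: "cmod (of_real t + c) < T" "Re (g (of_real t)) \<ge> a - cmod (of_real t) * (M * R + a * p) / (R\<^sup>2 - p\<^sup>2)"
    by (rule Re_lower_bound_disc[OF g _ a(1) g0 D T0 TR cp small], erule gM)+
  show "z \<in> ball 0 R" unfolding \<theta>(2) by (rule iffD1[OF disc bd(1)])
  show "real_deriv f z v \<bullet> e \<ge> a - norm (z - z0) * (M * R + a * p) / (R\<^sup>2 - p\<^sup>2)"
    using bd(2) unfolding gRe[OF bd(1)] t unfolding t_def[symmetric] \<theta>(2)[symmetric] .
qed

text \<open>The derivative along a segment has a positive component in one fixed direction \<open>e\<close>, so \<open>f\<close> cannot take the same value
at both ends. On a sphere of radius \<open>t\<close> about \<open>z0\<close> the values of \<open>f\<close> have distance at least \<open>a t - a t\<^sup>2 / (2 r)\<close> from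
\<open>f z0\<close>; as injective continuous maps are open, the image covers the ball of this radius, and \<open>t\<close> may tend to \<open>r\<close>.\<close>

lemma schlicht_ball_criterion:
  fixes f :: "complex^'n \<Rightarrow> complex^'n"
  assumes cont: "continuous_on (ball z0 r) f" and sub: "ball z0 r \<subseteq> ball 0 1" and r: "0 < r" and a: "0 < a"
    and der: "\<And>x s v e. x + s *\<^sub>R v \<in> ball z0 r \<Longrightarrow>
      ((\<lambda>t. f (x + t *\<^sub>R v) \<bullet> e) has_real_derivative L (x + s *\<^sub>R v) v \<bullet> e) (at s)"
    and L: "\<And>v. norm v = 1 \<Longrightarrow> \<exists>e. norm e = 1 \<and> (\<forall>z\<in>ball z0 r. L z v \<bullet> e \<ge> a * (1 - norm (z - z0) / r))"
  shows "schlicht_ball f (f z0) (a * r / 2)"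
proof -
  have inj: "inj_on f (ball z0 r)"
  proof (rule inj_onI, rule ccontr)
    fix x y assume xy: "x \<in> ball z0 r" "y \<in> ball z0 r" "f x = f y" "x \<noteq> y"
    define l where "l = norm (y - x)"
    define v where "v = (1 / l) *\<^sub>R (y - x)"
    have l: "l > 0" using xy by (simp add: l_def)
    have v: "norm v = 1" "y = x + l *\<^sub>R v" using l by (simp_all add: v_def l_def)
    obtain e where e: "\<forall>z\<in>ball z0 r. L z v \<bullet> e \<ge> a * (1 - norm (z - z0) / r)"
      using L[OF v(1)] by blast
    have seg: "x + s *\<^sub>R v \<in> ball z0 r" if "0 \<le> s" "s \<le> l" for s
    proof -
      have "x + s *\<^sub>R v = (1 - s / l) *\<^sub>R x + (s / l) *\<^sub>R y"
        using l by (simp add: v(2) algebra_simps)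
      then show ?thesis
        using xy that l convexD_alt[OF convex_ball, of x z0 r y "s / l"] by simp
    qed
    obtain s where s: "0 < s" "s < l"
      "f (x + l *\<^sub>R v) \<bullet> e - f (x + 0 *\<^sub>R v) \<bullet> e = (l - 0) * (L (x + s *\<^sub>R v) v \<bullet> e)"
      using MVT2[of 0 l "\<lambda>t. f (x + t *\<^sub>R v) \<bullet> e" "\<lambda>s. L (x + s *\<^sub>R v) v \<bullet> e"] l der seg by blast
    have "norm (x + s *\<^sub>R v - z0) < r"
      using seg[of s] s by (simp add: dist_norm norm_minus_commute)
    then have "0 < a * (1 - norm (x + s *\<^sub>R v - z0) / r)" using a r by simp
    also have "\<dots> \<le> L (x + s *\<^sub>R v) v \<bullet> e" using e seg[of s] s by auto
    finally show False using s l xy v(2) by simp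
  qed
  define q where "q = (\<lambda>t. a * t - a * t\<^sup>2 / (2 * r))"
  have grow: "q t \<le> norm (f z - f z0)" if z: "norm (z - z0) = t" and t: "0 < t" "t < r" for z t
  proof -
    define v where "v = (1 / t) *\<^sub>R (z - z0)"
    have v: "norm v = 1" "z = z0 + t *\<^sub>R v" using t z by (simp_all add: v_def)
    obtain e where e: "norm e = 1" "\<forall>z\<in>ball z0 r. L z v \<bullet> e \<ge> a * (1 - norm (z - z0) / r)"
      using L[OF v(1)] by blast
    have seg: "z0 + s *\<^sub>R v \<in> ball z0 r" if "0 \<le> s" "s \<le> t" for s
      using that t v by (simp add: dist_norm)
    have "f (z0 + 0 *\<^sub>R v) \<bullet> e - q 0 \<le> f (z0 + t *\<^sub>R v) \<bullet> e - q t"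
    proof (rule DERIV_nonneg_imp_nondecreasing[where f = "\<lambda>s. f (z0 + s *\<^sub>R v) \<bullet> e - q s"])
      show "0 \<le> t" using t by simp
      fix s assume s: "0 \<le> s" "s \<le> t"
      have "((\<lambda>s. f (z0 + s *\<^sub>R v) \<bullet> e - q s) has_real_derivative L (z0 + s *\<^sub>R v) v \<bullet> e - a * (1 - s / r)) (at s)"
        unfolding q_def using r
        by (auto intro!: derivative_eq_intros der seg s simp: field_simps)
      moreover have "0 \<le> L (z0 + s *\<^sub>R v) v \<bullet> e - a * (1 - s / r)"
        using e(2) seg[OF s] s v by force
      ultimately show "\<exists>y. ((\<lambda>s. f (z0 + s *\<^sub>R v) \<bullet> e - q s) has_real_derivative y) (at s) \<and> 0 \<le> y"
        by blast
    qed
    then have "q t \<le> (f z - f z0) \<bullet> e" by (simp add: v(2) q_def inner_diff_left)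
    also have "\<dots> \<le> norm (f z - f z0) * norm e" by (rule norm_cauchy_schwarz)
    finally show ?thesis using e by simp
  qed
  have cover: "ball (f z0) (a * r / 2) \<subseteq> f ` ball z0 r"
  proof
    fix w assume w: "w \<in> ball (f z0) (a * r / 2)"
    have "(q \<longlongrightarrow> q r) (at_left r)" unfolding q_def using r by (intro tendsto_intros) auto
    moreover have "q r = a * r / 2" using r by (simp add: q_def power2_eq_square field_simps)
    ultimately have "\<forall>\<^sub>F t in at_left r. dist (f z0) w < q t"
      using w by (intro order_tendstoD(1)) auto
    moreover have "\<forall>\<^sub>F t in at_left r. t \<in> {0<..<r}"
      by (rule eventually_at_leftI[OF _ r]) auto
    ultimately have "\<forall>\<^sub>F t in at_left r. dist (f z0) w < q t \<and> t \<in> {0<..<r}"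
      by (rule eventually_conj)
    from eventually_happens'[OF trivial_limit_at_left_real this]
    obtain t where t: "dist (f z0) w < q t" "0 < t" "t < r" by auto
    have "ball (f z0) (q t) \<subseteq> f ` ball z0 t"
    proof (rule ball_subset_open_map_image)
      show "continuous_on (closure (ball z0 t)) f"
        using t by (intro continuous_on_subset[OF cont]) auto
      show "open (f ` interior (ball z0 t))"
        using t by (intro invariance_of_domain continuous_on_subset[OF cont] inj_on_subset[OF inj]) auto
      show "q t \<le> norm (f z - f z0)" if "z \<in> frontier (ball z0 t)" for z
        using that t grow[of z t] by (simp add: dist_norm norm_minus_commute)
      show "0 < q t" using t(1) zero_le_dist[of "f z0" w] by linarith
    qed (use t in auto)
    then have "w \<in> f ` ball z0 t" using t by auto
    then show "w \<in> f ` ball z0 r" using t by auto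
  qed
  define G where "G = ball z0 r \<inter> f -` ball (f z0) (a * r / 2)"
  have fG: "f ` G = ball (f z0) (a * r / 2)" using cover by (auto simp: G_def)
  have "open G" unfolding G_def by (rule continuous_open_preimage[OF cont]) auto
  moreover have "connected G"
  proof -
    obtain g where g: "homeomorphism (ball z0 r) (f ` ball z0 r) f g"
      using invariance_of_domain_homeomorphism[OF open_ball cont _ inj] by auto
    have "G = g ` ball (f z0) (a * r / 2)"
    proof -
      have "g (f x) = x" if "x \<in> G" for x
        using homeomorphism_apply1[OF g] that by (simp add: G_def)
      then show ?thesis unfolding fG[symmetric] by (simp add: image_image)
    qed
    moreover have "connected (g ` ball (f z0) (a * r / 2))"
      using homeomorphism_cont2[OF g] cover
      by (intro connected_continuous_image continuous_on_subset[OF _ cover]) auto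
    ultimately show ?thesis by simp
  qed
  moreover have "z0 \<in> G" using r a by (simp add: G_def)
  moreover have "G \<subseteq> ball 0 1" using sub by (auto simp: G_def)
  moreover have "inj_on f G" using inj by (rule inj_on_subset) (auto simp: G_def)
  ultimately show ?thesis
    unfolding schlicht_ball_def using fG by (intro exI[of _ G]) auto
qed

text \<open>For each direction the unit vector \<open>e\<close> is chosen as the normalised derivative at \<open>z0\<close> in this direction.\<close>

lemma Landau_schlicht_ball:
  fixes f :: "complex^'n \<Rightarrow> complex^'n"
  assumes f: "\<And>j. slice_harmonic_on (ball 0 1) (\<lambda>z. f z $ j)" and R: "R \<le> 1"
    and M: "\<And>z \<theta>. z \<in> ball 0 R \<Longrightarrow> norm \<theta> = 1 \<Longrightarrow> norm (real_deriv f z \<theta>) \<le> M"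
    and p: "norm z0 \<le> p" "p < R" and a: "0 < a" "\<And>\<theta>. norm \<theta> = 1 \<Longrightarrow> a \<le> norm (real_deriv f z0 \<theta>)"
  shows "schlicht_ball f (f z0) (a\<^sup>2 * (R\<^sup>2 - p\<^sup>2) / (2 * (M * R + a * p)))"
proof -
  have sub: "ball 0 R \<subseteq> (ball 0 1 :: (complex^'n) set)" using R by auto
  define r where "r = a * (R\<^sup>2 - p\<^sup>2) / (M * R + a * p)"
  have p0: "0 \<le> p" using p norm_ge_zero[of z0] by linarith
  have z0: "z0 \<in> ball 0 R" using p by simp
  obtain \<theta>0 :: "complex^'n" where \<theta>0: "norm \<theta>0 = 1" by (rule vector_choose_size[of 1]) auto
  have "0 < M" using a(1) a(2)[OF \<theta>0] M[OF z0 \<theta>0] by linarith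
  then have den: "0 < M * R + a * p" using p p0 a by (intro add_pos_nonneg) auto
  have pR: "p\<^sup>2 < R\<^sup>2" using p p0 by (intro power_strict_mono) auto
  have r: "0 < r" using den pR a by (simp add: r_def)
  have ex: "\<exists>e. norm e = 1 \<and> a \<le> real_deriv f z0 v \<bullet> e" if "norm v = 1" for v
  proof (intro exI conjI)
    let ?w = "real_deriv f z0 v"
    have w: "a \<le> norm ?w" using a(2)[OF that] .
    then have "?w \<noteq> 0" using a by auto
    then show "norm (sgn ?w) = 1" by (simp add: norm_sgn)
    have "?w \<bullet> sgn ?w = norm ?w" using \<open>?w \<noteq> 0\<close> by (simp add: sgn_div_norm flip: norm_eq_sqrt_inner power2_norm_eq_inner) (simp add: power2_eq_square)
    then show "a \<le> ?w \<bullet> sgn ?w" using w by simp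
  qed
  have in_ball: "norm (z - z0) < r" if "z \<in> ball z0 r" for z
    using that by (simp add: dist_norm norm_minus_commute)
  have low: "z \<in> ball 0 R" "real_deriv f z v \<bullet> e \<ge> a - norm (z - z0) * (M * R + a * p) / (R\<^sup>2 - p\<^sup>2)"
    if "norm v = 1" "norm e = 1" "a \<le> real_deriv f z0 v \<bullet> e" "norm (z - z0) < r" for z v e
    by (rule real_deriv_inner_lower_bound[OF open_ball f sub M p a(1) that(3,1,2) that(4)[unfolded r_def]]; assumption)+
  have bR: "ball z0 r \<subseteq> ball 0 R"
  proof
    fix z assume "z \<in> ball z0 r"
    then show "z \<in> ball 0 R"
      using ex[OF \<theta>0] low(1)[OF \<theta>0] in_ball by blast
  qed
  have "schlicht_ball f (f z0) (a * r / 2)"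
  proof (rule schlicht_ball_criterion[where L = "real_deriv f"])
    have "continuous_on (ball 0 1) (\<lambda>z. \<chi> j. f z $ j)"
      using f by (intro continuous_on_vec_lambda) (simp add: slice_harmonic_on_def)
    then show "continuous_on (ball z0 r) f"
      by (simp add: continuous_on_subset[OF _ order_trans[OF bR sub]])
    show "\<exists>e. norm e = 1 \<and> (\<forall>z\<in>ball z0 r. real_deriv f z v \<bullet> e \<ge> a * (1 - norm (z - z0) / r))"
      if v: "norm v = 1" for v
    proof -
      obtain e where e: "norm e = 1" "a \<le> real_deriv f z0 v \<bullet> e" using ex[OF v] by blast
      have ar: "a / r = (M * R + a * p) / (R\<^sup>2 - p\<^sup>2)" using a(1) by (simp add: r_def)
      have "a * (1 - norm (z - z0) / r) \<le> real_deriv f z v \<bullet> e" if "z \<in> ball z0 r" for z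
      proof -
        have "a * (1 - norm (z - z0) / r) = a - norm (z - z0) * (a / r)"
          by (simp add: algebra_simps)
        then show ?thesis
          using low(2)[OF v e in_ball[OF that]] unfolding ar by simp
      qed
      then show ?thesis using e by blast
    qed
    show "((\<lambda>t. f (x + t *\<^sub>R v) \<bullet> e) has_real_derivative real_deriv f (x + s *\<^sub>R v) v \<bullet> e) (at s)"
      if "x + s *\<^sub>R v \<in> ball z0 r" for x s v e
      using that bR sub by (intro has_real_derivative_inner_line[OF open_ball f]) blast
  qed (use order_trans[OF bR sub] r a in simp_all)
  moreover have "a * r / 2 = a\<^sup>2 * (R\<^sup>2 - p\<^sup>2) / (2 * (M * R + a * p))"
    by (simp only: r_def power2_eq_square times_divide_eq_right divide_divide_eq_left mult_ac)
  ultimately show ?thesis by (simp only:)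
qed

section \<open>The arithmetic of escaping points\<close>

text \<open>The hypothesis \<open>escape\<close> describes a point \<open>z0\<close>, with \<open>|z0| \<le> p\<close> and \<open>u z0 \<ge> m\<close>, whose image is not the centre of a
sufficiently large schlicht ball: if \<open>R\<close> and \<open>m'\<close> satisfy the two inequalities, then \<open>u\<close> exceeds \<open>m'\<close> somewhere in the ball of radius
\<open>R\<close>. The constant \<open>1.5708\<close> is an upper bound for \<open>\<pi>/2\<close>. Since \<open>u \<le> Y\<close>, a contradiction arises as soon as \<open>R = 1\<close> and \<open>m' = Y\<close> are
admissible, and this happens when \<open>m\<close> is not too small compared with \<open>Y\<close>.

Near the boundary, with \<open>d = 1 - p\<close>, the first inequality only involves \<open>d m\<^sup>3\<close>, \<open>Y / m\<close> and \<open>m' / m\<close> up to small errors. With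
\<open>d m\<^sup>3 = 0.78732\<close>, either \<open>Y\<close> is within reach or \<open>m\<close> can be doubled while \<open>d\<close> is divided by \<open>8\<close>, which preserves \<open>d m\<^sup>3\<close>. Two steps,
to the radii \<open>0.79\<close> and \<open>0.96\<close>, lead from the origin to this regime. The second of them reaches a larger value the larger \<open>Y\<close>
is, and for small \<open>Y\<close> the process ends before the doubling starts; hence the case distinctions in \<open>Y\<close>.\<close>

lemma no_escape:
  fixes u :: "'a::real_normed_vector \<Rightarrow> real" and Y :: real
  assumes Y: "1 \<le> Y" and u0: "u 0 = 1" and uY: "\<And>z. z \<in> ball 0 1 \<Longrightarrow> u z \<le> Y"
    and escape: "\<And>z0 p R m m'. norm z0 \<le> p \<Longrightarrow> p < R \<Longrightarrow> R \<le> 1 \<Longrightarrow> 1 \<le> m \<Longrightarrow> m \<le> u z0 \<Longrightarrow>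
      3 * (R\<^sup>2 - p\<^sup>2) * m ^ 4 * Y \<ge> 1.5708 * (R * Y * m' + m\<^sup>2 * p) \<Longrightarrow>
      2 * (R\<^sup>2 - p\<^sup>2) * m ^ 4 \<ge> 1.5708 * (R + p) \<Longrightarrow> \<exists>z\<in>ball 0 R. m' < u z"
  shows False
proof -
  have finish: "3 * (1 - p\<^sup>2) * m ^ 4 * Y < 1.5708 * (Y * Y + m\<^sup>2 * p)"
    if "norm z0 \<le> p" "p < 1" "1 \<le> m" "m \<le> u z0" "2 * (1 - p\<^sup>2) * m ^ 4 \<ge> 1.5708 * (1 + p)" for z0 p m
    using escape[of z0 p 1 m Y] that uY by (force simp: not_less not_le)
  have Y1: "1.9 < Y"
  proof (rule ccontr)
    assume "\<not> 1.9 < Y"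
    then have "Y * Y \<le> 1.9 * Y" using Y by (intro mult_right_mono) auto
    then show False using finish[of 0 0 1] u0 Y by simp
  qed
  obtain z1 where z1: "norm z1 \<le> 0.79" "1.508 \<le> u z1"
  proof -
    have "\<exists>z\<in>ball 0 0.79. 1.508 < u z"
      using escape[of 0 0 "0.79" 1 "1.508"] u0 Y by (simp add: power2_eq_square)
    then obtain z where "z \<in> ball 0 0.79" "1.508 < u z" by blast
    then show thesis using that[of z] by simp
  qed
  have Y2: "3.12 < Y"
  proof (rule ccontr)
    assume "\<not> 3.12 < Y"
    \<comment> \<open>The inequality to be refuted is quadratic in \<open>Y\<close>; on the interval \<open>Y\<^sup>2\<close> lies below its chord, which leaves a linear one.\<close>
    then have "0 \<le> (Y - 1.9) * (3.12 - Y)" using Y1 by (intro mult_nonneg_nonneg) auto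
    then have "Y * Y \<le> 5.02 * Y - 5.928" by (simp add: field_simps)
    moreover have "3 * (1 - 0.79\<^sup>2) * 1.508 ^ 4 * Y < 1.5708 * (Y * Y + 1.508\<^sup>2 * (0.79::real))"
      by (rule finish[OF z1(1) _ _ z1(2)]) (simp_all add: eval_nat_numeral)
    ultimately show False using \<open>\<not> 3.12 < Y\<close> by (simp add: eval_nat_numeral)
  qed
  have second: "\<exists>z. norm z \<le> 0.96 \<and> m' \<le> u z" if "1.507968 * (Y * m') + 2.822 \<le> 4.6154 * Y" for m'
  proof -
    have "\<exists>z\<in>ball 0 0.96. m' < u z"
      by (rule escape[OF z1(1) _ _ _ z1(2)]) (use that Y2 in \<open>simp_all add: eval_nat_numeral field_simps\<close>)
    then obtain z where "z \<in> ball 0 0.96" "m' < u z" by blast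
    then show ?thesis by (intro exI[of _ z]) simp
  qed
  have Y3: "4 < Y"
  proof (rule ccontr)
    assume n: "\<not> 4 < Y"
    then have "0 \<le> (Y - 3.12) * (4 - Y)" using Y2 by (intro mult_nonneg_nonneg) auto
    then have "Y * Y \<le> 7.12 * Y - 12.48" by (simp add: field_simps)
    moreover obtain z where z: "norm z \<le> 0.96" "2.46 \<le> u z" using second[of "2.46"] Y2 by auto
    have "3 * (1 - 0.96\<^sup>2) * 2.46 ^ 4 * Y < 1.5708 * (Y * Y + 2.46\<^sup>2 * (0.96::real))"
      by (rule finish[OF z(1) _ _ z(2)]) (simp_all add: eval_nat_numeral)
    ultimately show False using n by (simp add: eval_nat_numeral)
  qed
  have Y4: "5.5 < Y"
  proof (rule ccontr)
    assume n: "\<not> 5.5 < Y"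
    then have "0 \<le> (Y - 4) * (5.5 - Y)" using Y3 by (intro mult_nonneg_nonneg) auto
    then have "Y * Y \<le> 9.5 * Y - 22" by (simp add: field_simps)
    moreover obtain z where z: "norm z \<le> 0.96" "2.59 \<le> u z" using second[of "2.59"] Y3 by auto
    have "3 * (1 - 0.96\<^sup>2) * 2.59 ^ 4 * Y < 1.5708 * (Y * Y + 2.59\<^sup>2 * (0.96::real))"
      by (rule finish[OF z(1) _ _ z(2)]) (simp_all add: eval_nat_numeral)
    ultimately show False using n by (simp add: eval_nat_numeral)
  qed
  have chain: "\<exists>z. norm z \<le> 1 - 0.04 / 8 ^ k \<and> 2.7 * 2 ^ k \<le> u z" for k
  proof (induction k)
    case 0
    show ?case using second[of "2.7"] Y4 by simp
  next
    case (Suc k)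
    define d :: real where "d = 0.04 / 8 ^ k"
    define m :: real where "m = 2.7 * 2 ^ k"
    have d: "0 < d" "d \<le> 0.04" by (simp_all add: d_def divide_le_eq)
    have m: "2.7 \<le> m" by (simp add: m_def)
    have "(8::real) ^ k = (2 ^ k) ^ 3" 
    proof -
      have "(8::real) ^ k = (2 ^ 3) ^ k" by simp
      also have "\<dots> = (2 ^ k) ^ 3" by (simp only: power_mult[symmetric] mult.commute)
      finally show ?thesis .
    qed
    then have dm: "d * m ^ 3 = 0.78732" by (simp add: d_def m_def power_mult_distrib eval_nat_numeral)
    obtain z where z: "norm z \<le> 1 - d" "m \<le> u z" using Suc by (auto simp: d_def m_def)
    have "norm z < 1" using z d by linarith
    then have mY: "m \<le> Y" using uY[of z] z by simp
    have m4: "x * d * m ^ 4 = x * 0.78732 * m" for x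
      using dm by (simp add: power4_eq_xxxx power3_eq_cube)
    have "2.35 * m < Y"
    proof (rule ccontr)
      assume n: "\<not> 2.35 * m < Y"
      then have "0 \<le> (Y - m) * (2.35 * m - Y)" using mY by (intro mult_nonneg_nonneg) auto
      then have YY: "Y * Y + m\<^sup>2 \<le> 3.35 * (m * Y) - 1.35 * m\<^sup>2" by (simp add: field_simps power2_eq_square)
      have D: "1.96 * d \<le> 1 - (1 - d)\<^sup>2"
        using d mult_right_mono[of d "0.04" d] by (simp add: power2_eq_square field_simps)
      have D4: "1.96 * 0.78732 * m \<le> (1 - (1 - d)\<^sup>2) * m ^ 4"
        using mult_right_mono[OF D, of "m ^ 4"] m unfolding m4 by simp
      have "3 * (1 - (1 - d)\<^sup>2) * m ^ 4 * Y < 1.5708 * (Y * Y + m\<^sup>2 * (1 - d))"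
      proof (rule finish[OF z(1) _ _ z(2)])
        define E where "E = (1 - (1 - d)\<^sup>2) * m ^ 4"
        have "1.5708 * (1 + (1 - d)) \<le> 2 * E"
          using D4[folded E_def] d m by simp
        then show "1.5708 * (1 + (1 - d)) \<le> 2 * (1 - (1 - d)\<^sup>2) * m ^ 4"
          by (simp only: E_def mult.assoc)
      qed (use d m in auto)
      also have "\<dots> \<le> 1.5708 * (Y * Y + m\<^sup>2)" using d by (simp add: mult_left_le)
      also have "\<dots> \<le> 1.5708 * (3.35 * (m * Y) - 1.35 * m\<^sup>2)" by (rule mult_left_mono[OF YY]) simp
      also have "\<dots> \<le> 4.62 * (m * Y)"
      proof -
        define A B where "A = m * Y" and "B = m\<^sup>2"
        have "Y * m \<le> (2.35 * m) * m" using n m by (intro mult_right_mono) auto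
        then have "A \<le> 2.35 * B" by (simp add: A_def B_def power2_eq_square mult.commute)
        moreover have "0 \<le> B" by (simp add: B_def)
        ultimately show ?thesis unfolding A_def[symmetric] B_def[symmetric] by (simp add: field_simps)
      qed
      finally have "3 * ((1 - (1 - d)\<^sup>2) * m ^ 4) * Y < 4.62 * (m * Y)" by (simp only: mult.assoc)
      moreover have "3 * (1.96 * 0.78732 * m) * Y \<le> 3 * ((1 - (1 - d)\<^sup>2) * m ^ 4) * Y"
        using D4 Y by (intro mult_right_mono mult_left_mono) auto
      ultimately have "3 * (1.96 * 0.78732 * m) * Y < 4.62 * (m * Y)" by (rule order_le_less_trans[rotated])
      moreover have "0 < Y * m" using m Y by simp
      ultimately show False by (simp add: mult.commute)
    qed
    have D: "1.7106 * d \<le> (1 - d / 8)\<^sup>2 - (1 - d)\<^sup>2"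
      using d mult_right_mono[of d "0.04" d] by (simp add: power2_eq_square field_simps)
    have D4: "1.7106 * 0.78732 * m \<le> ((1 - d / 8)\<^sup>2 - (1 - d)\<^sup>2) * m ^ 4"
      using mult_right_mono[OF D, of "m ^ 4"] m unfolding m4 by simp
    have "\<exists>z\<in>ball 0 (1 - d / 8). 2 * m < u z"
    proof (rule escape[OF z(1) _ _ _ z(2)])
      define A where "A = m * Y"
      have A: "0 < A" using m Y by (simp add: A_def)
      have "(1 - d / 8) * Y * (2 * m) \<le> 1 * Y * (2 * m)"
        using d m Y by (intro mult_right_mono) auto
      then have 1: "(1 - d / 8) * Y * (2 * m) \<le> 2 * A" by (simp add: A_def mult_ac)
      have "m\<^sup>2 * (1 - d) \<le> m\<^sup>2" using d by (simp add: mult_left_le)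
      also have "m\<^sup>2 \<le> m * (Y / 2.35)"
        using \<open>2.35 * m < Y\<close> m unfolding power2_eq_square by (intro mult_left_mono) auto
      also have "\<dots> = A / 2.35" by (simp add: A_def)
      finally have 2: "m\<^sup>2 * (1 - d) \<le> A / 2.35" .
      have "1.5708 * ((1 - d / 8) * Y * (2 * m) + m\<^sup>2 * (1 - d)) \<le> 1.5708 * (2 * A + A / 2.35)"
        by (intro mult_left_mono add_mono 1 2) simp
      also have "\<dots> \<le> 3 * (1.7106 * 0.78732) * A" using A by simp
      also have "\<dots> = 3 * (1.7106 * 0.78732 * m) * Y" by (simp add: A_def)
      also have "\<dots> \<le> 3 * (((1 - d / 8)\<^sup>2 - (1 - d)\<^sup>2) * m ^ 4) * Y"
        using D4 Y by (intro mult_right_mono mult_left_mono) auto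
      finally show "1.5708 * ((1 - d / 8) * Y * (2 * m) + m\<^sup>2 * (1 - d))
          \<le> 3 * ((1 - d / 8)\<^sup>2 - (1 - d)\<^sup>2) * m ^ 4 * Y"
        by (simp only: mult.assoc)
      define E where "E = ((1 - d / 8)\<^sup>2 - (1 - d)\<^sup>2) * m ^ 4"
      have "1.5708 * ((1 - d / 8) + (1 - d)) \<le> 2 * E"
        using D4[folded E_def] d m by simp
      then show "1.5708 * ((1 - d / 8) + (1 - d)) \<le> 2 * ((1 - d / 8)\<^sup>2 - (1 - d)\<^sup>2) * m ^ 4"
        by (simp only: E_def mult.assoc)
    qed (use d m in auto)
    then obtain z' where "z' \<in> ball 0 (1 - d / 8)" "2 * m < u z'" by blast
    then show ?case by (intro exI[of _ z']) (simp add: d_def m_def)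
  qed
  obtain k where k: "Y < 2 ^ k" using real_arch_pow[of 2 Y] by auto
  obtain z where z: "norm z \<le> 1 - 0.04 / 8 ^ k" "2.7 * 2 ^ k \<le> u z" using chain by blast
  have "norm z < 1" using z(1) by (rule order_le_less_trans) simp
  then have "u z \<le> Y" using uY[of z] by simp
  moreover have "0 < (2::real) ^ k" by simp
  ultimately show False using z(2) k by simp
qed

section \<open>Mappings with the quasiregularity bound\<close>

lemma norm_real_deriv_le_Lambda_max:
  assumes "norm \<theta> = 1"
  shows "norm (real_deriv f z \<theta>) \<le> Lambda_max f z"
proof -
  obtain B where B: "\<And>x. norm (real_deriv f z x) \<le> B * norm x"
    using linear_bounded[OF linear_real_deriv[of f z]] by blast
  have "bdd_above ((\<lambda>\<theta>. norm (real_deriv f z \<theta>)) ` sphere 0 1)"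
  proof (rule bdd_aboveI2)
    show "norm (real_deriv f z x) \<le> B" if "x \<in> sphere 0 1" for x
      using B[of x] that by simp
  qed
  then show ?thesis
    unfolding Lambda_max_def real_deriv_def[symmetric] using assms by (intro cSUP_upper) auto
qed

lemma lambda_min_le_norm_real_deriv:
  assumes "norm \<theta> = 1"
  shows "lambda_min f z \<le> norm (real_deriv f z \<theta>)"
  unfolding lambda_min_def real_deriv_def[symmetric]
  using assms by (intro cINF_lower bdd_belowI2[of _ 0]) auto

lemma lambda_min_nonneg: "0 \<le> lambda_min f (z :: complex^'n)"
proof -
  obtain \<theta> :: "complex^'n" where "norm \<theta> = 1" by (rule vector_choose_size[of 1]) auto
  then have "sphere (0 :: complex^'n) 1 \<noteq> {}" by auto
  then show ?thesis unfolding lambda_min_def by (rule cINF_greatest) simp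
qed

lemma lambda_min_le_Lambda_max: "lambda_min f (z :: complex^'n) \<le> Lambda_max f z"
proof -
  obtain \<theta> :: "complex^'n" where "norm \<theta> = 1" by (rule vector_choose_size[of 1]) auto
  then show ?thesis
    using lambda_min_le_norm_real_deriv norm_real_deriv_le_Lambda_max order_trans by blast
qed

text \<open>For \<open>u > Y \<ge> 1\<close> the exponent \<open>n \<ge> 2\<close> gives \<open>u\<^sup>2 \<le> u\<^sup>n = \<lambda> \<le> K u + K'\<close>, which is false beyond the positive root of the quadratic.\<close>

lemma root_lambda_min_le:
  fixes f :: "complex^'n \<Rightarrow> complex^'n"
  assumes n: "CARD('n) > 1" and qr: "Lambda_max f z \<le> K * root CARD('n) (lambda_min f z) + K'"
    and Y: "1 \<le> Y" "K \<le> Y" "Y * Y = K * Y + K'"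
  shows "root CARD('n) (lambda_min f z) \<le> Y"
proof (rule ccontr)
  define u where "u = root CARD('n) (lambda_min f z)"
  assume "\<not> root CARD('n) (lambda_min f z) \<le> Y"
  then have u: "Y < u" by (simp add: u_def)
  have "u\<^sup>2 \<le> u ^ CARD('n)" using u Y n by (intro power_increasing) auto
  also have "\<dots> = lambda_min f z" using n by (simp add: u_def lambda_min_nonneg)
  also have "\<dots> \<le> K * u + K'" using lambda_min_le_Lambda_max[of f z] qr by (simp add: u_def)
  finally have "u * u \<le> K * u + K'" by (simp add: power2_eq_square)
  moreover have "0 < (u - Y) * (u + Y - K)" using u Y by (intro mult_pos_pos) auto
  ultimately show False using Y(3) by (simp add: algebra_simps)
qed

text \<open>The Landau theorem with \<open>a = m\<^sup>2\<close>, a lower bound for \<open>\<lambda> = u\<^sup>n\<close>, and \<open>M = K m' + K'\<close>. The inequality \<open>c1\<close> is the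
required comparison of radii for \<open>K = Y\<close>, \<open>K' = 0\<close>, and \<open>c2\<close>, together with \<open>m \<le> Y\<close>, implies it for \<open>K = 0\<close>, \<open>K' = Y\<^sup>2\<close>.\<close>

lemma schlicht_ball_from_bounded_growth:
  fixes f :: "complex^'n \<Rightarrow> complex^'n"
  assumes n: "CARD('n) > 1" and f: "\<And>j. slice_harmonic_on (ball 0 1) (\<lambda>z. f z $ j)"
    and qr: "\<And>z. z \<in> ball 0 1 \<Longrightarrow> Lambda_max f z \<le> K * root CARD('n) (lambda_min f z) + K'"
    and K: "1 \<le> K" "0 \<le> K'" and Y: "K \<le> Y" "Y * Y = K * Y + K'"
    and p: "norm z0 \<le> p" "p < R" "R \<le> 1" and m: "1 \<le> m" "m \<le> root CARD('n) (lambda_min f z0)"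
    and growth: "\<And>z. z \<in> ball 0 R \<Longrightarrow> root CARD('n) (lambda_min f z) \<le> m'"
    and c1: "3 * (R\<^sup>2 - p\<^sup>2) * m ^ 4 * Y \<ge> 1.5708 * (R * Y * m' + m\<^sup>2 * p)"
    and c2: "2 * (R\<^sup>2 - p\<^sup>2) * m ^ 4 \<ge> 1.5708 * (R + p)"
  shows "\<exists>b. pi / (4 * (3 * K + 2 * K')) \<le> b \<and> schlicht_ball f (f z0) b"
proof (intro exI conjI)
  define u where "u = (\<lambda>z. root CARD('n) (lambda_min f z))"
  define M where "M = K * m' + K'"
  define D where "D = R\<^sup>2 - p\<^sup>2"
  have p0: "0 \<le> p" using p norm_ge_zero[of z0] by linarith
  have z0: "z0 \<in> ball 0 R" using p by simp
  have m': "m \<le> m'" using m growth[OF z0] by simp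
  have "root CARD('n) (lambda_min f z0) \<le> Y"
    using p K Y by (intro root_lambda_min_le[OF n qr]) auto
  then have mY: "m \<le> Y" using m by simp
  have "m\<^sup>2 \<le> u z0 ^ 2" using m by (intro power_mono) (auto simp: u_def)
  also have "\<dots> \<le> u z0 ^ CARD('n)"
  proof (rule power_increasing)
    show "1 \<le> u z0" unfolding u_def using m by linarith
  qed (use n in simp)
  also have "\<dots> = lambda_min f z0" using n by (simp add: u_def lambda_min_nonneg)
  finally have lam: "m\<^sup>2 \<le> lambda_min f z0" .
  have bound: "norm (real_deriv f z \<theta>) \<le> M" if z: "z \<in> ball 0 R" and \<theta>: "norm \<theta> = 1" for z \<theta>
  proof -
    have "norm (real_deriv f z \<theta>) \<le> Lambda_max f z" by (rule norm_real_deriv_le_Lambda_max[OF \<theta>])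
    also have "\<dots> \<le> K * u z + K'" using qr[of z] z p by (simp add: u_def)
    also have "\<dots> \<le> M" using growth[OF z] K by (simp add: M_def u_def)
    finally show ?thesis .
  qed
  show "schlicht_ball f (f z0) ((m\<^sup>2)\<^sup>2 * (R\<^sup>2 - p\<^sup>2) / (2 * (M * R + m\<^sup>2 * p)))"
    by (rule Landau_schlicht_ball[OF f p(3) bound p(1,2)])
       (use m lam lambda_min_le_norm_real_deriv[of _ f z0] in \<open>auto intro: order_trans\<close>)
  have D: "0 < D" using p p0 by (simp add: D_def power_strict_mono)
  have M: "0 < M" using K m m' by (simp add: M_def add_pos_nonneg)
  have den: "0 < M * R + m\<^sup>2 * p" using M p p0 by (intro add_pos_nonneg) auto
  have Kpos: "0 < 3 * K + 2 * K'" using K by simp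
  have Ypos: "0 < Y" using K Y by simp
  \<comment> \<open>With \<open>K' = Y (Y - K)\<close> both sides are affine in \<open>K\<close>, so the general case is a convex combination of the two extreme ones.\<close>
  have K': "K' = Y * (Y - K)" using Y(2) by (simp add: algebra_simps)
  have c2': "1.5708 * (R * Y\<^sup>2 + m\<^sup>2 * p) \<le> 2 * D * m ^ 4 * Y\<^sup>2"
  proof -
    have "m\<^sup>2 * p \<le> Y\<^sup>2 * p" using m mY p0 by (intro mult_right_mono power_mono) auto
    then have "1.5708 * (R * Y\<^sup>2 + m\<^sup>2 * p) \<le> 1.5708 * (R + p) * Y\<^sup>2" by (simp add: algebra_simps)
    also have "\<dots> \<le> 2 * D * m ^ 4 * Y\<^sup>2" using c2 by (intro mult_right_mono) (auto simp: D_def)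
    finally show ?thesis .
  qed
  have split: "Y * (c * (M * R + m\<^sup>2 * p)) =
      K * (c * (R * Y * m' + m\<^sup>2 * p)) + (Y - K) * (c * (R * Y\<^sup>2 + m\<^sup>2 * p))" for c
    by (simp add: M_def K' power2_eq_square algebra_simps)
  have "Y * (1.5708 * (M * R + m\<^sup>2 * p)) =
      K * (1.5708 * (R * Y * m' + m\<^sup>2 * p)) + (Y - K) * (1.5708 * (R * Y\<^sup>2 + m\<^sup>2 * p))"
    by (rule split)
  also have "\<dots> \<le> K * (3 * D * m ^ 4 * Y) + (Y - K) * (2 * D * m ^ 4 * Y\<^sup>2)"
    using c1 c2' K Y by (intro add_mono mult_left_mono) (auto simp: D_def)
  also have "\<dots> = Y * (D * m ^ 4 * (3 * K + 2 * K'))"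
    by (simp add: K' power2_eq_square algebra_simps)
  finally have "1.5708 * (M * R + m\<^sup>2 * p) \<le> D * m ^ 4 * (3 * K + 2 * K')"
    using Ypos by (simp only: mult_le_cancel_left_pos)
  moreover have "pi / 2 * (M * R + m\<^sup>2 * p) \<le> 1.5708 * (M * R + m\<^sup>2 * p)"
    using pi_approx(2) den by (intro mult_right_mono) auto
  ultimately have "pi * (2 * (M * R + m\<^sup>2 * p)) \<le> (D * m ^ 4) * (4 * (3 * K + 2 * K'))"
    by (simp add: algebra_simps)
  then have "pi * (2 * (M * R + m\<^sup>2 * p)) \<le> ((m\<^sup>2)\<^sup>2 * D) * (4 * (3 * K + 2 * K'))"
    by (simp add: mult.commute[of D])
  moreover have "0 < 4 * (3 * K + 2 * K')" "0 < 2 * (M * R + m\<^sup>2 * p)"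
    using Kpos den by simp_all
  ultimately show "pi / (4 * (3 * K + 2 * K')) \<le> (m\<^sup>2)\<^sup>2 * (R\<^sup>2 - p\<^sup>2) / (2 * (M * R + m\<^sup>2 * p))"
    unfolding D_def[symmetric] by (simp only: pos_divide_le_eq pos_le_divide_eq times_divide_eq_left)
qed

theorem theorem4:
  fixes f :: "complex^'n \<Rightarrow> complex^'n" and K K' :: real
  assumes "CARD('n) > 1"
    and "K \<ge> 1" and "K' \<ge> 0"
    and "quasiregular_pluriharmonic K K' f"
    and "lambda_min f 0 = 1"
  shows "\<exists>w b. b \<ge> pi / (4 * (3 * K + 2 * K')) \<and> ball w b \<subseteq> f ` ball 0 1 \<and> schlicht_ball f w b"
proof (rule ccontr)
  assume contr: "\<not> ?thesis"
  \<comment> \<open>The positive root of \<open>Y\<^sup>2 = K Y + K'\<close>.\<close>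
  define Y where "Y = (K + sqrt (K\<^sup>2 + 4 * K')) / 2"
  have "K \<le> sqrt (K\<^sup>2 + 4 * K')" using assms(2,3) by (intro real_le_rsqrt) auto
  then have KY: "K \<le> Y" by (simp add: Y_def)
  have "2 * Y - K = sqrt (K\<^sup>2 + 4 * K')" by (simp add: Y_def field_simps)
  then have "(2 * Y - K)\<^sup>2 = K\<^sup>2 + 4 * K'" using assms(2,3) by simp
  then have YY: "Y * Y = K * Y + K'" by (simp add: power2_eq_square algebra_simps)
  have f: "slice_harmonic_on (ball 0 1) (\<lambda>z. f z $ j)" for j
    using assms(4) unfolding quasiregular_pluriharmonic_def pluriharmonic_map_on_def
    by (intro slice_harmonic_on_if_pluriharmonic_on) auto
  have qr: "Lambda_max f z \<le> K * root CARD('n) (lambda_min f z) + K'" if "z \<in> ball 0 1" for z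
    using assms(4) that unfolding quasiregular_pluriharmonic_def by blast
  have no: "\<not> (\<exists>b. pi / (4 * (3 * K + 2 * K')) \<le> b \<and> schlicht_ball f w b)" for w
    using contr unfolding schlicht_ball_def by (metis image_mono)
  show False
  proof (rule no_escape[of Y "\<lambda>z. root CARD('n) (lambda_min f z)"])
    show "1 \<le> Y" using KY assms(2) by simp
    show "root CARD('n) (lambda_min f 0) = 1" using assms(1,5) by simp
    show "root CARD('n) (lambda_min f z) \<le> Y" if "z \<in> ball 0 1" for z
      using KY YY assms(1,2) qr[OF that] by (intro root_lambda_min_le) auto
    fix z0 :: "complex^'n" and p R m m' :: real
    assume *: "norm z0 \<le> p" "p < R" "R \<le> 1" "1 \<le> m" "m \<le> root CARD('n) (lambda_min f z0)"
      "1.5708 * (R * Y * m' + m\<^sup>2 * p) \<le> 3 * (R\<^sup>2 - p\<^sup>2) * m ^ 4 * Y"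
      "1.5708 * (R + p) \<le> 2 * (R\<^sup>2 - p\<^sup>2) * m ^ 4"
    show "\<exists>z\<in>ball 0 R. m' < root CARD('n) (lambda_min f z)"
    proof (rule ccontr)
      assume "\<not> ?thesis"
      then have "root CARD('n) (lambda_min f z) \<le> m'" if "z \<in> ball 0 R" for z
        using that by (auto simp: not_less)
      from schlicht_ball_from_bounded_growth[OF assms(1) f qr assms(2,3) KY YY *(1-5) this *(6,7)]
      show False using no by blast
    qed
  qed
qed

end
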